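(* Let $X$ be a standard Borel space and let $\rho:X\times X\to[0,+\infty]$ be a Borel proper extended metric on $X$. If the Borel asymptotic dimension of $(X,\rho)$ is finite, then the finite-distance equivalence relation $E_\rho=\{(x,y)\in X\times X:\rho(x,y)<\infty\}$ is hyperfinite.
   Context: An extended metric is a metric allowed to take the value $+\infty$. It is proper if every ball of finite radius has finite cardinality. The Borel asymptotic dimension of $(X,\rho)$ is the least $d\in\mathbb{N}$ such that for every $r>0$ there is a Borel equivalence relation $E$ on $X$, with a finite uniform bound on the $\rho$-diameters of its classes, such that every closed $\rho$-ball of radius $r$ meets at most $d+1$ classes of $E$; it is $\infty$ if no such $d$ exists. An equivalence relation on $X$ is Borel if it is a Borel subset of $X\times X$, finite if all its classes are finite, and hyperfinite if it is the union of an increasing sequence of finite Borel equivalence relations. *)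

theory Defs
  imports "HOL-Analysis.Analysis"
begin

text \<open>Only the underlying measurable space \<open>(space M, sets M)\<close> of a
  \<^typ>\<open>'a measure\<close> is used throughout.\<close>

definition standard_borel :: "'a measure \<Rightarrow> bool" where
  "standard_borel M \<longleftrightarrow>
     (\<exists>T. topspace T = space M \<and> completely_metrizable_space T \<and> separable_space T \<and>
          sets M = sigma_sets (space M) {U. openin T U})"

definition extended_metric_on :: "'a set \<Rightarrow> ('a \<Rightarrow> 'a \<Rightarrow> ennreal) \<Rightarrow> bool" where
  "extended_metric_on X \<rho> \<longleftrightarrow>
     (\<forall>x\<in>X. \<forall>y\<in>X. \<rho> x y = 0 \<longleftrightarrow> x = y) \<and>
     (\<forall>x\<in>X. \<forall>y\<in>X. \<rho> x y = \<rho> y x) \<and>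
     (\<forall>x\<in>X. \<forall>y\<in>X. \<forall>z\<in>X. \<rho> x z \<le> \<rho> x y + \<rho> y z)"

definition ext_cball :: "'a set \<Rightarrow> ('a \<Rightarrow> 'a \<Rightarrow> ennreal) \<Rightarrow> 'a \<Rightarrow> real \<Rightarrow> 'a set" where
  "ext_cball X \<rho> x r = {y\<in>X. \<rho> x y \<le> ennreal r}"

definition proper_on :: "'a set \<Rightarrow> ('a \<Rightarrow> 'a \<Rightarrow> ennreal) \<Rightarrow> bool" where
  "proper_on X \<rho> \<longleftrightarrow> (\<forall>x\<in>X. \<forall>r::real. finite (ext_cball X \<rho> x r))"

definition ext_diameter :: "('a \<Rightarrow> 'a \<Rightarrow> ennreal) \<Rightarrow> 'a set \<Rightarrow> ennreal" where
  "ext_diameter \<rho> C = (SUP x\<in>C. SUP y\<in>C. \<rho> x y)"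

text \<open>For a standard Borel space \<open>M\<close>, the product \<open>\<sigma>\<close>-algebra of \<open>M \<Otimes>\<^sub>M M\<close> is the Borel
  \<open>\<sigma>\<close>-algebra of the product topology.\<close>

definition borel_equiv :: "'a measure \<Rightarrow> 'a rel \<Rightarrow> bool" where
  "borel_equiv M E \<longleftrightarrow> equiv (space M) E \<and> E \<in> sets (M \<Otimes>\<^sub>M M)"

definition finite_borel_equiv :: "'a measure \<Rightarrow> 'a rel \<Rightarrow> bool" where
  "finite_borel_equiv M E \<longleftrightarrow> borel_equiv M E \<and> (\<forall>C\<in>space M // E. finite C)"

definition hyperfinite :: "'a measure \<Rightarrow> 'a rel \<Rightarrow> bool" where
  "hyperfinite M E \<longleftrightarrow>
     (\<exists>F::nat \<Rightarrow> 'a rel. (\<forall>n. finite_borel_equiv M (F n)) \<and> incseq F \<and> E = (\<Union>n. F n))"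

definition borel_asdim_le :: "'a measure \<Rightarrow> ('a \<Rightarrow> 'a \<Rightarrow> ennreal) \<Rightarrow> nat \<Rightarrow> bool" where
  "borel_asdim_le M \<rho> d \<longleftrightarrow>
     (\<forall>r::real. r > 0 \<longrightarrow>
        (\<exists>E. borel_equiv M E \<and>
             (\<exists>R<\<infinity>. \<forall>C\<in>space M // E. ext_diameter \<rho> C \<le> R) \<and>
             (\<forall>x\<in>space M.
                finite {C\<in>space M // E. C \<inter> ext_cball (space M) \<rho> x r \<noteq> {}} \<and>
                card {C\<in>space M // E. C \<inter> ext_cball (space M) \<rho> x r \<noteq> {}} \<le> d + 1)))"

text \<open>In \<^typ>\<open>enat\<close>, the infimum of a nonempty set is its least element, and the infimum of
  the empty set is \<open>\<infinity>\<close>.\<close>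

definition borel_asdim :: "'a measure \<Rightarrow> ('a \<Rightarrow> 'a \<Rightarrow> ennreal) \<Rightarrow> enat" where
  "borel_asdim M \<rho> = Inf {enat d | d. borel_asdim_le M \<rho> d}"

definition finite_distance_rel :: "'a set \<Rightarrow> ('a \<Rightarrow> 'a \<Rightarrow> ennreal) \<Rightarrow> 'a rel" where
  "finite_distance_rel X \<rho> = {(x, y) \<in> X \<times> X. \<rho> x y < \<infinity>}"

end

theory Submission
  imports Defs
begin

text \<open>
  Iterating the definition of asymptotic dimension \<open>d\<close> along growing radii, each time coarsening the
  previous relation, gives an increasing sequence of uniformly bounded Borel equivalence relations
  \<open>F n\<close> such that every ball of radius \<open>n\<close> meets at most \<open>2 ^ (d + 1)\<close> classes of \<open>F n\<close>. Hence each
  finite-distance class splits into finitely many classes of the union of the \<open>F n\<close>, and a hyperfinite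
  relation of finite index in another makes the larger one hyperfinite: choose for every \<open>x\<close> a ball
  \<open>S x\<close> meeting all the classes at finite distance, and identify \<open>x\<close> and \<open>y\<close> at stage \<open>k\<close> when \<open>S x\<close>
  and \<open>S y\<close> meet the same classes of \<open>F k\<close>. All these relations are Borel because a Borel set with
  finite sections has a Borel projection, which rests on Novikov's separation theorem for analytic sets.
\<close>

section \<open>Analytic sets\<close>

text \<open>The relations supplied at different radii are unrelated, and joining them could chain
  classes together without bound. Comparing saturations avoids this: points are identified when
  their classes in the old relation meet the same classes of the new one, so the old relation is
  contained in the result and the diameter bounds merely add up. The price is the exponential, since
  a class is now indexed by a set of at most \<open>d + 1\<close> classes. This price does not
  compound, because each count uses the diameter bound of the previous relation and never its count;
  only a bound independent of \<open>n\<close> leaves finitely many classes in the limit. In general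
  the union of the \<open>F n\<close> has no Borel set of representatives. A ball of canonical
  radius replaces a choice of representatives, and since it is finite, every comparison between two
  such balls is settled at a finite stage.\<close>

definition analytic_set :: "'b::topological_space set \<Rightarrow> bool" where
  "analytic_set P \<longleftrightarrow>
     (\<exists>(C :: (nat \<Rightarrow> nat) set) f. closed C \<and> continuous_on C f \<and> P = f ` C)"

lemma analytic_setE:
  assumes "analytic_set P"
  obtains C :: "(nat \<Rightarrow> nat) set" and f
  where "closed C" "continuous_on C f" "P = f ` C"
  using assms unfolding analytic_set_def by blast

lemma analytic_set_image:
  assumes "analytic_set P" "continuous_on P g"
  shows "analytic_set (g ` P)"
proof -
  obtain C :: "(nat \<Rightarrow> nat) set" and f where C: "closed C" "continuous_on C f" "P = f ` C"
    using assms(1) by (rule analytic_setE)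
  then have "continuous_on C (g \<circ> f)" using assms(2) by (intro continuous_on_compose) auto
  then show ?thesis unfolding analytic_set_def using C by (metis image_comp)
qed

text \<open>Any closed set may parametrise, so cutting it down to a closed preimage stays within the
  definition, even when the result is empty.\<close>

lemma analytic_set_Int_closed:
  assumes "analytic_set P" "closed K"
  shows "analytic_set (P \<inter> K)"
proof -
  obtain C :: "(nat \<Rightarrow> nat) set" and f where C: "closed C" "continuous_on C f" "P = f ` C"
    using assms(1) by (rule analytic_setE)
  have "closed (C \<inter> f -` K)" using C assms by (intro continuous_closed_preimage)
  moreover have "continuous_on (C \<inter> f -` K) f" using C(2) continuous_on_subset by blast
  moreover have "P \<inter> K = f ` (C \<inter> f -` K)" using C by auto
  ultimately show ?thesis unfolding analytic_set_def by blast
qed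

section \<open>Sequence spaces and countable operations on analytic sets\<close>

lemma open_seq_cylinder:
  fixes U :: "(nat \<Rightarrow> 'a::topological_space) set"
  assumes "open U" "\<sigma> \<in> U"
  obtains n where "\<And>\<tau>. (\<And>i. i < n \<Longrightarrow> \<tau> i = \<sigma> i) \<Longrightarrow> \<tau> \<in> U"
proof -
  obtain X where X: "\<sigma> \<in> Pi\<^sub>E UNIV X" "finite {i. X i \<noteq> topspace (euclidean::'a topology)}" "Pi\<^sub>E UNIV X \<subseteq> U"
    using assms product_topology_open_contains_basis[of "\<lambda>_. euclidean" UNIV U \<sigma>]
    unfolding open_fun_def by blast
  obtain n where n: "\<And>i. X i \<noteq> UNIV \<Longrightarrow> i < n"
    using X(2) finite_nat_set_iff_bounded[of "{i. X i \<noteq> topspace (euclidean::'a topology)}"] by auto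
  have "\<tau> \<in> U" if "\<And>i. i < n \<Longrightarrow> \<tau> i = \<sigma> i" for \<tau>
  proof -
    have "\<tau> i \<in> X i" for i using that[of i] n[of i] X(1) by (cases "X i = UNIV") (auto simp: PiE_iff)
    then show ?thesis using X(3) by (auto simp: PiE_iff)
  qed
  then show ?thesis by (rule that)
qed

lemma open_cylinder: "open {\<tau> :: nat \<Rightarrow> 'a::discrete_topology. \<forall>i<n. \<tau> i = \<sigma> i}"
proof -
  have "{\<tau> :: nat \<Rightarrow> 'a. \<forall>i<n. \<tau> i = \<sigma> i} = (\<Inter>i\<in>{..<n}. (\<lambda>\<tau>. \<tau> i) -` {\<sigma> i})" by auto
  also have "open \<dots>"
    by (intro open_INT ballI open_vimage[OF _ continuous_on_product_coordinates] open_discrete finite_lessThan)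
  finally show ?thesis .
qed

lemma closed_seqI:
  fixes C :: "(nat \<Rightarrow> 'a::topological_space) set"
  assumes "closed C" "\<And>n. \<exists>\<tau>\<in>C. \<forall>i<n. \<tau> i = \<sigma> i"
  shows "\<sigma> \<in> C"
proof (rule ccontr)
  assume "\<sigma> \<notin> C"
  then obtain n where n: "\<And>\<tau>. (\<And>i. i < n \<Longrightarrow> \<tau> i = \<sigma> i) \<Longrightarrow> \<tau> \<in> - C"
    using open_seq_cylinder[of "- C" \<sigma>] assms(1) by auto
  then show False using assms(2)[of n] by blast
qed

lemma continuous_on_seqD:
  fixes C :: "(nat \<Rightarrow> 'a::topological_space) set"
  assumes "continuous_on C f" "\<sigma> \<in> C" "open U" "f \<sigma> \<in> U"
  shows "\<exists>n. \<forall>\<tau>\<in>C. (\<forall>i<n. \<tau> i = \<sigma> i) \<longrightarrow> f \<tau> \<in> U"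
proof -
  obtain A where A: "open A" "\<sigma> \<in> A" "\<And>y. y \<in> C \<Longrightarrow> y \<in> A \<Longrightarrow> f y \<in> U"
    using assms unfolding continuous_on_topological by metis
  obtain n where "\<And>\<tau>. (\<And>i. i < n \<Longrightarrow> \<tau> i = \<sigma> i) \<Longrightarrow> \<tau> \<in> A"
    using open_seq_cylinder[OF A(1,2)] by blast
  then show ?thesis using A(3) by blast
qed

text \<open>Entry 0 of a sequence names the piece and the remaining entries parametrise it. The
  conditions \<open>\<sigma> 0 = i\<close> are open, so the maps of the pieces are glued without
  interference.\<close>

lemma analytic_set_UN:
  fixes P :: "nat \<Rightarrow> 'b::topological_space set"
  assumes "\<And>i. analytic_set (P i)"
  shows "analytic_set (\<Union>i. P i)"
proof -
  have "\<forall>i. \<exists>(C :: (nat \<Rightarrow> nat) set) f. closed C \<and> continuous_on C f \<and> P i = f ` C"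
    using assms unfolding analytic_set_def by blast
  then obtain C :: "nat \<Rightarrow> (nat \<Rightarrow> nat) set" and f
    where C: "\<And>i. closed (C i)" "\<And>i. continuous_on (C i) (f i)" "\<And>i. P i = f i ` C i"
    by metis
  define sh :: "(nat \<Rightarrow> nat) \<Rightarrow> nat \<Rightarrow> nat" where "sh \<sigma> n = \<sigma> (Suc n)" for \<sigma> n
  \<comment> \<open>Membership is phrased as an implication for every \<open>i\<close>, which
    exhibits \<open>D\<close> as an intersection of closed sets.\<close>
  define D where "D = {\<sigma>. \<forall>i. \<sigma> 0 = i \<longrightarrow> \<sigma> \<in> sh -` C i}"
  define g where "g \<sigma> = f (\<sigma> 0) (sh \<sigma>)" for \<sigma>
  have csh: "continuous_on UNIV sh"
    unfolding sh_def by (intro continuous_on_coordinatewise_then_product continuous_on_product_coordinates)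
  have op: "open {\<sigma> :: nat \<Rightarrow> nat. \<sigma> 0 = i}" for i
    using open_cylinder[of 1 "\<lambda>_. i"] by simp
  have "closed (sh -` C i)" for i using csh C(1) closed_vimage by blast
  then have "closed D" unfolding D_def
    by (intro closed_Collect_all closed_Collect_imp op) (simp add: vimage_def)
  moreover have "continuous_on D g"
    unfolding continuous_on_topological
  proof (intro ballI allI impI)
    fix \<sigma> B assume a: "\<sigma> \<in> D" "open B" "g \<sigma> \<in> B"
    have "sh \<sigma> \<in> C (\<sigma> 0)" using a by (auto simp: D_def)
    moreover have "f (\<sigma> 0) (sh \<sigma>) \<in> B" using a by (simp add: g_def)
    ultimately obtain A where A: "open A" "sh \<sigma> \<in> A" "\<And>y. y \<in> C (\<sigma> 0) \<Longrightarrow> y \<in> A \<Longrightarrow> f (\<sigma> 0) y \<in> B"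
      using C(2)[of "\<sigma> 0"] a(2) unfolding continuous_on_topological by metis
    have "open (sh -` A \<inter> {\<tau>. \<tau> 0 = \<sigma> 0})"
      using csh A(1) op by (intro open_Int open_vimage)
    moreover have "g y \<in> B" if "y \<in> D" "y \<in> sh -` A \<inter> {\<tau>. \<tau> 0 = \<sigma> 0}" for y
      using that A(3) by (auto simp: g_def D_def)
    ultimately show "\<exists>A. open A \<and> \<sigma> \<in> A \<and> (\<forall>y\<in>D. y \<in> A \<longrightarrow> g y \<in> B)"
      using A(2) by (intro exI[of _ "sh -` A \<inter> {\<tau>. \<tau> 0 = \<sigma> 0}"]) auto
  qed
  moreover have "(\<Union>i. P i) = g ` D"
  proof safe
    fix i x assume "x \<in> P i"
    then obtain \<sigma> where s: "\<sigma> \<in> C i" "x = f i \<sigma>" using C(3) by auto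
    have "sh (case_nat i \<sigma>) = \<sigma>" by (auto simp: sh_def)
    then have "g (case_nat i \<sigma>) = x" "case_nat i \<sigma> \<in> D" using s by (auto simp: g_def D_def)
    then show "x \<in> g ` D" by blast
  next
    fix \<sigma> assume "\<sigma> \<in> D"
    then have "g \<sigma> \<in> P (\<sigma> 0)" using C(3) by (auto simp: D_def g_def)
    then show "g \<sigma> \<in> (\<Union>i. P i)" by blast
  qed
  ultimately show ?thesis unfolding analytic_set_def by blast
qed

text \<open>One sequence codes countably many through \<open>prod_encode\<close>, and the parameter
  set asks that all of them be mapped to the same value. Distances turn this agreement into a closed
  condition.\<close>

lemma analytic_set_INT:
  fixes P :: "nat \<Rightarrow> 'b::metric_space set"
  assumes "\<And>i. analytic_set (P i)"
  shows "analytic_set (\<Inter>i. P i)"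
proof -
  have "\<forall>i. \<exists>(C :: (nat \<Rightarrow> nat) set) f. closed C \<and> continuous_on C f \<and> P i = f ` C"
    using assms unfolding analytic_set_def by blast
  then obtain C :: "nat \<Rightarrow> (nat \<Rightarrow> nat) set" and f
    where C: "\<And>i. closed (C i)" "\<And>i. continuous_on (C i) (f i)" "\<And>i. P i = f i ` C i"
    by metis
  define p :: "nat \<Rightarrow> (nat \<Rightarrow> nat) \<Rightarrow> nat \<Rightarrow> nat" where "p i \<sigma> n = \<sigma> (prod_encode (i, n))" for i \<sigma> n
  have cp: "continuous_on UNIV (p i)" for i
    unfolding p_def by (intro continuous_on_coordinatewise_then_product continuous_on_product_coordinates)
  define D where "D = (\<Inter>i. p i -` C i)"
  have clD: "closed D" unfolding D_def using cp C(1) by (intro closed_INT ballI closed_vimage)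
  have cf: "continuous_on D (\<lambda>\<sigma>. f i (p i \<sigma>))" for i
    by (rule continuous_on_compose2[OF C(2)[of i]])
      (use continuous_on_subset[OF cp[of i] subset_UNIV] in \<open>auto simp: D_def\<close>)
  define K where "K = (\<Inter>i. D \<inter> (\<lambda>\<sigma>. dist (f i (p i \<sigma>)) (f 0 (p 0 \<sigma>))) -` {0})"
  have "closed K" unfolding K_def
    by (intro closed_INT ballI continuous_closed_preimage clD continuous_on_dist cf) auto
  moreover have "continuous_on K (\<lambda>\<sigma>. f 0 (p 0 \<sigma>))"
    using cf[of 0] by (rule continuous_on_subset) (auto simp: K_def)
  moreover have "(\<Inter>i. P i) = (\<lambda>\<sigma>. f 0 (p 0 \<sigma>)) ` K"
  proof safe
    fix x assume "x \<in> (\<Inter>i. P i)"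
    then have "\<forall>i. \<exists>\<sigma>. \<sigma> \<in> C i \<and> x = f i \<sigma>" using C(3) by auto
    then obtain \<sigma> where s: "\<And>i. \<sigma> i \<in> C i" "\<And>i. x = f i (\<sigma> i)" by metis
    define \<tau> where "\<tau> k = \<sigma> (fst (prod_decode k)) (snd (prod_decode k))" for k
    have p: "p i \<tau> = \<sigma> i" for i by (auto simp: p_def \<tau>_def)
    then have "\<tau> \<in> K" using s unfolding K_def D_def by (simp add: s(2)[symmetric])
    then show "x \<in> (\<lambda>\<sigma>. f 0 (p 0 \<sigma>)) ` K" using p s by (intro image_eqI[of _ _ \<tau>]) auto
  next
    fix \<sigma> i assume s: "\<sigma> \<in> K"
    then have "f i (p i \<sigma>) = f 0 (p 0 \<sigma>)" "p i \<sigma> \<in> C i" by (auto simp: K_def D_def)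
    then show "f 0 (p 0 \<sigma>) \<in> P i" using C(3) by (metis imageI)
  qed
  ultimately show ?thesis unfolding analytic_set_def by blast
qed

section \<open>Borel sets of Polish spaces are analytic\<close>

lemma analytic_set_UNIV: "analytic_set (UNIV :: 'b::polish_space set)"
proof -
  obtain Q :: "'b set" where Q: "countable Q" "\<And>X. open X \<Longrightarrow> X \<noteq> {} \<Longrightarrow> \<exists>d\<in>Q. d \<in> X"
    by (rule countable_dense_setE) blast
  have "Q \<noteq> {}" using Q(2)[of UNIV] by auto
  then have rq: "range (from_nat_into Q) = Q" using Q(1) by (rule range_from_nat_into)
  define q where "q = from_nat_into Q"
  have dense: "\<exists>n. dist (q n) x < e" if "e > 0" for x e
  proof -
    have "\<exists>d\<in>Q. d \<in> ball x e" using Q(2)[of "ball x e"] that by auto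
    then obtain d where "d \<in> Q" "dist d x < e" by (auto simp: dist_commute)
    then show ?thesis using rq unfolding q_def by (metis rangeE)
  qed
  \<comment> \<open>Summable steps force convergence at a rate independent of
    \<open>\<sigma>\<close>, so the limit map \<open>f\<close> is continuous on \<open>C\<close>;
    the condition itself is closed.\<close>
  define C :: "(nat \<Rightarrow> nat) set" where "C = {\<sigma>. \<forall>n. dist (q (\<sigma> n)) (q (\<sigma> (Suc n))) \<le> (1/2)^n}"
  define f where "f \<sigma> = lim (\<lambda>n. q (\<sigma> n))" for \<sigma> :: "nat \<Rightarrow> nat"
  have cq: "continuous_on UNIV (\<lambda>\<sigma>. q (\<sigma> n))" for n
    by (rule continuous_on_compose2[of UNIV q]) auto
  have "closed C" unfolding C_def
    by (intro closed_Collect_all closed_Collect_le continuous_on_dist cq continuous_on_const)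
  \<comment> \<open>The right-hand side is the exact geometric sum of the \<open>k\<close> steps
    from \<open>n\<close> on, which is what lets the induction close.\<close>
  have step: "dist (q (\<sigma> n)) (q (\<sigma> (n + k))) \<le> 2 * (1/2)^n - 2 * (1/2)^(n+k)" if "\<sigma> \<in> C" for \<sigma> n k
  proof (induction k)
    case (Suc k)
    have "dist (q (\<sigma> n)) (q (\<sigma> (n + Suc k))) \<le> dist (q (\<sigma> n)) (q (\<sigma> (n + k))) + dist (q (\<sigma> (n + k))) (q (\<sigma> (Suc (n + k))))"
      using dist_triangle by simp
    also have "\<dots> \<le> 2 * (1/2)^n - 2 * (1/2)^(n+k) + (1/2)^(n+k)"
      using Suc that by (intro add_mono) (auto simp: C_def)
    finally show ?case by simp
  qed simp
  then have le: "dist (q (\<sigma> n)) (q (\<sigma> m)) \<le> 2 * (1/2)^n" if "\<sigma> \<in> C" "n \<le> m" for \<sigma> n m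
    using step[OF that(1), of n "m - n"] that(2) by (simp add: order_trans[of _ "2 * (1/2)^n - 2 * (1/2)^m"])
  have small: "\<exists>N. 2 * (1/2)^N < e" if "e > 0" for e :: real
  proof -
    have "\<exists>N. (1/2)^N < e/2" using that by (intro real_arch_pow_inv) auto
    then show ?thesis by (simp add: field_simps)
  qed
  have conv: "(\<lambda>n. q (\<sigma> n)) \<longlonglongrightarrow> f \<sigma>" if "\<sigma> \<in> C" for \<sigma>
  proof -
    have "Cauchy (\<lambda>n. q (\<sigma> n))"
    proof (rule metric_CauchyI)
      fix e :: real assume "e > 0"
      then obtain N where N: "2 * (1/2)^N < e/2" using small[of "e/2"] by auto
      have "dist (q (\<sigma> m)) (q (\<sigma> n)) < e" if "m \<ge> N" "n \<ge> N" for m n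
        using le[OF \<open>\<sigma> \<in> C\<close> that(1)] le[OF \<open>\<sigma> \<in> C\<close> that(2)] N
          dist_triangle3[of "q (\<sigma> m)" "q (\<sigma> n)" "q (\<sigma> N)"] by linarith
      then show "\<exists>M. \<forall>m\<ge>M. \<forall>n\<ge>M. dist (q (\<sigma> m)) (q (\<sigma> n)) < e" by blast
    qed
    then show ?thesis unfolding f_def using Cauchy_convergent convergent_LIMSEQ_iff by blast
  qed
  have lef: "dist (q (\<sigma> n)) (f \<sigma>) \<le> 2 * (1/2)^n" if "\<sigma> \<in> C" for \<sigma> n
  proof (rule Lim_dist_ubound[OF _ conv[OF that]])
    show "\<forall>\<^sub>F m in sequentially. dist (q (\<sigma> n)) (q (\<sigma> m)) \<le> 2 * (1/2)^n"
      using le[OF that] by (auto simp: eventually_sequentially)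
  qed simp
  have "uniform_limit C (\<lambda>n \<sigma>. q (\<sigma> n)) f sequentially"
  proof (rule uniform_limitI)
    fix e :: real assume "e > 0"
    then obtain N where N: "2 * (1/2)^N < e" using small by auto
    have "dist (q (\<sigma> n)) (f \<sigma>) < e" if "n \<ge> N" "\<sigma> \<in> C" for n \<sigma>
    proof -
      have "(1/2::real)^n \<le> (1/2)^N" using that by (intro power_decreasing) auto
      then show ?thesis using lef[OF that(2), of n] N by linarith
    qed
    then show "\<forall>\<^sub>F n in sequentially. \<forall>\<sigma>\<in>C. dist (q (\<sigma> n)) (f \<sigma>) < e"
      by (auto simp: eventually_sequentially)
  qed
  then have "continuous_on C f"
    by (rule uniform_limit_theorem[rotated]) (auto intro!: always_eventually continuous_on_subset[OF cq])
  moreover have "UNIV = f ` C"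
  proof safe
    fix x :: 'b
    \<comment> \<open>The extra factor 1/2 leaves room for the triangle inequality: consecutive
      terms differ by at most 1/2 + 1/4 of \<open>(1/2)^n\<close>.\<close>
    have "\<exists>k. dist (q k) x < (1/2)^n / 2" for n by (intro dense) simp
    then obtain \<sigma> where s: "\<And>n. dist (q (\<sigma> n)) x < (1/2)^n / 2" by metis
    have "dist (q (\<sigma> n)) (q (\<sigma> (Suc n))) \<le> (1/2)^n" for n
    proof -
      have "(1/2::real)^n \<ge> 0" "dist (q (\<sigma> (Suc n))) x < (1/2)^n / 4" using s[of "Suc n"] by simp_all
      then show ?thesis
        using s[of n] dist_triangle2[of "q (\<sigma> n)" "q (\<sigma> (Suc n))" x] by linarith
    qed
    then have C: "\<sigma> \<in> C" by (simp add: C_def)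
    have "(\<lambda>n. dist (q (\<sigma> n)) x) \<longlonglongrightarrow> 0"
    proof (rule tendsto_sandwich[OF _ _ tendsto_const])
      have "(\<lambda>n. (1/2::real)^n / 2) \<longlonglongrightarrow> 0 / 2"
        by (intro tendsto_divide LIMSEQ_power_zero tendsto_const) auto
      then show "(\<lambda>n. (1/2::real)^n / 2) \<longlonglongrightarrow> 0" by simp
      show "\<forall>\<^sub>F n in sequentially. dist (q (\<sigma> n)) x \<le> (1/2)^n / 2"
        by (intro always_eventually allI less_imp_le s)
    qed simp
    then have "(\<lambda>n. q (\<sigma> n)) \<longlonglongrightarrow> x" by (rule tendsto_dist_iff[THEN iffD2])
    then have "f \<sigma> = x" by (rule LIMSEQ_unique[OF conv[OF C]])
    then show "x \<in> f ` C" using C by blast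
  qed auto
  ultimately show ?thesis unfolding analytic_set_def using \<open>closed C\<close> by blast
qed

lemma analytic_set_closed: "closed (K :: 'b::polish_space set) \<Longrightarrow> analytic_set K"
  using analytic_set_Int_closed[OF analytic_set_UNIV] by simp

text \<open>An open set is the countable union of the closed sets of points whose distance to its
  complement is at least \<open>1 / real (Suc n)\<close>. The whole space is set apart because
  \<open>infdist\<close> to the empty set is 0 by convention.\<close>

lemma analytic_set_open:
  assumes "open (U :: 'b::polish_space set)"
  shows "analytic_set U"
proof (cases "U = UNIV")
  case False
  have ne: "- U \<noteq> {}" using False by auto
  have U_eq: "U = (\<Union>n::nat. {x. infdist x (- U) \<ge> 1 / real (Suc n)})"
  proof safe
    fix x assume x: "x \<in> U"
    then have "infdist x (- U) > 0"
      using infdist_pos_not_in_closed[of "- U" x] assms ne by (simp add: closed_Compl)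
    then obtain n where "inverse (real (Suc n)) < infdist x (- U)" using reals_Archimedean by blast
    then show "x \<in> (\<Union>n::nat. {x. infdist x (- U) \<ge> 1 / real (Suc n)})"
      by (auto simp: inverse_eq_divide intro: less_imp_le)
  next
    fix x n assume "1 / real (Suc n) \<le> infdist x (- U)"
    moreover have "1 / real (Suc n) > 0" by simp
    ultimately show "x \<in> U" using infdist_zero[of x "- U"] by (cases "x \<in> U") auto
  qed
  have "closed {x. infdist x (- U) \<ge> 1 / real (Suc n)}" for n
    by (intro closed_Collect_le continuous_on_infdist continuous_on_const continuous_on_id)
  then show ?thesis by (subst U_eq) (intro analytic_set_UN analytic_set_closed)
qed (simp add: analytic_set_UNIV)

text \<open>Analyticity alone does not pass to complements, so the induction carries
  \<open>A\<close> and \<open>- A\<close> together: complementation swaps the two halves, and a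
  union on one side is an intersection on the other.\<close>

lemma analytic_set_borel:
  assumes "A \<in> sets (borel :: 'b::polish_space measure)"
  shows "analytic_set A"
proof -
  have "A \<in> sigma_sets UNIV {S. open S}" using assms by (simp add: borel_def)
  then have "analytic_set A \<and> analytic_set (- A)"
  proof induction
    case (Basic a)
    then show ?case by (simp add: analytic_set_open analytic_set_closed closed_Compl)
  next
    case Empty
    then show ?case by (simp add: analytic_set_closed)
  next
    case (Compl a)
    then show ?case by (simp add: Compl_eq_Diff_UNIV[symmetric])
  next
    case (Union a)
    then show ?case using analytic_set_UN[of a] analytic_set_INT[of "\<lambda>i. - a i"]
      by (simp add: Compl_UN)
  qed
  then show ?thesis ..
qed

section \<open>Separation and projections with finite sections\<close>

definition borel_separable :: "(nat \<Rightarrow> 'b::topological_space set) \<Rightarrow> bool" where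
  "borel_separable P \<longleftrightarrow>
     (\<exists>B. (\<forall>i. B i \<in> sets borel \<and> P i \<subseteq> B i) \<and> (\<Inter>i. B i) = {})"

text \<open>Take the union of the hulls at \<open>j\<close> and the intersections elsewhere: a
  common point lies in one \<open>B m j\<close>, and the intersections put it in every
  \<open>B m i\<close> for the same \<open>m\<close>. Read backwards, an inseparable sequence has an
  inseparable piece.\<close>

lemma borel_separable_UN:
  assumes "P j = (\<Union>m::nat. R m)" "\<And>m. borel_separable (P(j := R m))"
  shows "borel_separable P"
proof -
  have "\<forall>m. \<exists>B. (\<forall>i. B i \<in> sets borel \<and> (P(j := R m)) i \<subseteq> B i) \<and> (\<Inter>i. B i) = {}"
    using assms(2) unfolding borel_separable_def by blast
  then obtain B where B: "\<And>m i. B m i \<in> sets borel" "\<And>m i. (P(j := R m)) i \<subseteq> B m i" "\<And>m. (\<Inter>i. B m i) = {}"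
    by metis
  define B' where "B' i = (if i = j then (\<Union>m. B m i) else (\<Inter>m. B m i))" for i
  have "B' i \<in> sets borel" for i using B(1) by (auto simp: B'_def)
  moreover have "P i \<subseteq> B' i" for i
  proof (cases "i = j")
    case True
    have "R m \<subseteq> B m j" for m using B(2)[of m j] by simp
    then show ?thesis using True assms(1) by (auto simp: B'_def)
  next
    case False
    have "P i \<subseteq> B m i" for m using B(2)[of m i] False by simp
    then show ?thesis using False by (auto simp: B'_def)
  qed
  moreover have "(\<Inter>i. B' i) = {}"
  proof -
    have False if x: "\<And>i. x \<in> B' i" for x
    proof -
      obtain m where "x \<in> B m j" using x[of j] by (auto simp: B'_def)
      moreover have "x \<in> B m i" if "i \<noteq> j" for i using x[of i] that by (auto simp: B'_def)
      ultimately have "x \<in> (\<Inter>i. B m i)" by (metis INT_I)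
      then show False using B(3) by simp
    qed
    then show ?thesis by blast
  qed
  ultimately show ?thesis unfolding borel_separable_def by blast
qed

text \<open>Novikov's separation theorem. If separation failed, the closed sets parametrising the
  \<open>P i\<close> could be cut down one coordinate at a time, always keeping inseparability;
  the sequences obtained in the limit yield a point of every \<open>P i\<close>, or two distinct points
  with disjoint neighbourhoods that separate an earlier stage.\<close>

theorem novikov_separation:
  fixes P :: "nat \<Rightarrow> 'b::t2_space set"
  assumes an: "\<And>i. analytic_set (P i)" and empty: "(\<Inter>i. P i) = {}"
  shows "borel_separable P"
proof (rule ccontr)
  assume nsep: "\<not> borel_separable P"
  have "\<forall>i. \<exists>(C :: (nat \<Rightarrow> nat) set) f. closed C \<and> continuous_on C f \<and> P i = f ` C"
    using an unfolding analytic_set_def by blast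
  then obtain C :: "nat \<Rightarrow> (nat \<Rightarrow> nat) set" and f
    where C: "\<And>i. closed (C i)" "\<And>i. continuous_on (C i) (f i)" "\<And>i. P i = f i ` C i"
    by metis
  \<comment> \<open>One sequence \<open>\<tau>\<close> holds the candidates for all \<open>i\<close>
    at once, interleaved by \<open>prod_encode\<close>. Stage \<open>k\<close> fixes its first
    \<open>k\<close> entries, so only finitely many constraints are active.\<close>
  define Q where "Q \<tau> k i = f i ` {\<sigma> \<in> C i. \<forall>l. prod_encode (i, l) < k \<longrightarrow> \<sigma> l = \<tau> (prod_encode (i, l))}"
    for \<tau> :: "nat \<Rightarrow> nat" and k i
  have Q0: "Q \<tau> 0 = P" for \<tau> unfolding Q_def using C(3) by auto
  have Qcong: "Q \<tau> k = Q \<tau>' k" if "\<And>l. l < k \<Longrightarrow> \<tau> l = \<tau>' l" for \<tau> \<tau>' k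
    unfolding Q_def using that by (intro ext image_cong Collect_cong) auto
  have step: "\<exists>\<tau>'. \<not> borel_separable (Q \<tau>' (Suc k)) \<and> (\<forall>l. l \<noteq> k \<longrightarrow> \<tau>' l = \<tau> l)"
    if "\<not> borel_separable (Q \<tau> k)" for \<tau> k
  proof -
    \<comment> \<open>Entry \<open>k\<close> belongs to a single pair, so one step refines only the
      set with index \<open>j\<close>, which is the union over the possible values \<open>m\<close>
      of that entry.\<close>
    obtain j l0 where jl: "k = prod_encode (j, l0)" by (metis prod_decode_inverse surj_pair)
    have eq: "Q \<tau> k j = (\<Union>m. Q (\<tau>(k := m)) (Suc k) j)"
    proof safe
      fix x assume "x \<in> Q \<tau> k j"
      then obtain \<sigma> where s: "\<sigma> \<in> C j" "x = f j \<sigma>" "\<And>l. prod_encode (j, l) < k \<Longrightarrow> \<sigma> l = \<tau> (prod_encode (j, l))"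
        unfolding Q_def by auto
      have "\<sigma> l = (\<tau>(k := \<sigma> l0)) (prod_encode (j, l))" if "prod_encode (j, l) < Suc k" for l
        using s(3)[of l] that jl by (cases "l = l0") (auto simp: less_Suc_eq)
      then show "x \<in> (\<Union>m. Q (\<tau>(k := m)) (Suc k) j)" using s unfolding Q_def by blast
    next
      fix x m assume "x \<in> Q (\<tau>(k := m)) (Suc k) j"
      then obtain \<sigma> where s: "\<sigma> \<in> C j" "x = f j \<sigma>"
        "\<And>l. prod_encode (j, l) < Suc k \<Longrightarrow> \<sigma> l = (\<tau>(k := m)) (prod_encode (j, l))"
        unfolding Q_def by auto
      have "\<sigma> l = \<tau> (prod_encode (j, l))" if "prod_encode (j, l) < k" for l
        using s(3)[of l] that by auto
      then show "x \<in> Q \<tau> k j" using s unfolding Q_def by blast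
    qed
    have upd: "(Q \<tau> k)(j := Q (\<tau>(k := m)) (Suc k) j) = Q (\<tau>(k := m)) (Suc k)" for m
    proof
      fix i
      show "((Q \<tau> k)(j := Q (\<tau>(k := m)) (Suc k) j)) i = Q (\<tau>(k := m)) (Suc k) i"
      proof (cases "i = j")
        case False
        have "prod_encode (i, l) \<noteq> k" for l using jl False by simp
        then have *: "prod_encode (i, l) < Suc k \<longleftrightarrow> prod_encode (i, l) < k" "(\<tau>(k := m)) (prod_encode (i, l)) = \<tau> (prod_encode (i, l))" for l
          by (auto simp: less_Suc_eq)
        show ?thesis using False unfolding Q_def * by simp
      qed simp
    qed
    from borel_separable_UN[of "Q \<tau> k" j, OF eq] that
    obtain m where "\<not> borel_separable (Q (\<tau>(k := m)) (Suc k))" unfolding upd by blast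
    then show ?thesis by (intro exI[of _ "\<tau>(k := m)"]) auto
  qed
  have "\<exists>t. \<forall>k. \<not> borel_separable (Q (t k) k) \<and> (\<forall>l. l \<noteq> k \<longrightarrow> t (Suc k) l = t k l)"
    by (rule dependent_nat_choice) (use nsep step Q0 in auto)
  then obtain t where t: "\<And>k. \<not> borel_separable (Q (t k) k)" "\<And>k l. l \<noteq> k \<Longrightarrow> t (Suc k) l = t k l"
    by blast
  \<comment> \<open>Step \<open>k\<close> alters entry \<open>k\<close> only, so entry
    \<open>l\<close> is final from stage \<open>Suc l\<close> on, and the diagonal agrees with
    \<open>t k\<close> below \<open>k\<close>.\<close>
  define \<tau> where "\<tau> l = t (Suc l) l" for l
  have "t k l = \<tau> l" if "l < k" for k l
    using that
  proof (induction k)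
    case (Suc k)
    then show ?case using t(2)[of l k] by (cases "l = k") (auto simp: \<tau>_def)
  qed simp
  then have nQ: "\<not> borel_separable (Q \<tau> k)" for k
    using t(1)[of k] Qcong[of k \<tau> "t k"] by simp
  define \<sigma> where "\<sigma> i l = \<tau> (prod_encode (i, l))" for i l
  have ex_stage: "\<exists>k. \<forall>l<n. prod_encode (i, l) < k" for i n
  proof -
    have "prod_encode (i, l) < Suc (\<Sum>l<n. prod_encode (i, l))" if "l < n" for l
      using that member_le_sum[of l "{..<n}" "\<lambda>l. prod_encode (i, l)"] by (simp add: less_Suc_eq_le)
    then show ?thesis by blast
  qed
  \<comment> \<open>An empty member would be separated by the empty hull there and the whole space
    elsewhere.\<close>
  have Qne: "Q \<tau> k i \<noteq> {}" for k i
  proof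
    assume "Q \<tau> k i = {}"
    then have "borel_separable (Q \<tau> k)" unfolding borel_separable_def
      by (intro exI[of _ "(\<lambda>_. UNIV)(i := {})"]) auto
    then show False using nQ by blast
  qed
  have sC: "\<sigma> i \<in> C i" for i
  proof (rule closed_seqI[OF C(1)])
    fix n
    obtain k where k: "\<forall>l<n. prod_encode (i, l) < k" using ex_stage by blast
    obtain \<sigma>' where "\<sigma>' \<in> C i" "\<forall>l. prod_encode (i, l) < k \<longrightarrow> \<sigma>' l = \<tau> (prod_encode (i, l))"
      using Qne[of k i] unfolding Q_def by blast
    then show "\<exists>\<tau>\<in>C i. \<forall>l<n. \<tau> l = \<sigma> i l" using k by (auto simp: \<sigma>_def)
  qed
  have near: "\<exists>k. \<forall>k'\<ge>k. Q \<tau> k' i \<subseteq> U" if U: "open U" "f i (\<sigma> i) \<in> U" for i U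
  proof -
    obtain n where n: "\<forall>\<rho>\<in>C i. (\<forall>l<n. \<rho> l = \<sigma> i l) \<longrightarrow> f i \<rho> \<in> U"
      using continuous_on_seqD[of "C i" "f i" "\<sigma> i" U, OF C(2) sC U] by blast
    obtain k where k: "\<forall>l<n. prod_encode (i, l) < k" using ex_stage by blast
    have "Q \<tau> k' i \<subseteq> U" if "k' \<ge> k" for k'
      unfolding Q_def
    proof safe
      fix \<rho> assume r: "\<rho> \<in> C i" "\<forall>l. prod_encode (i, l) < k' \<longrightarrow> \<rho> l = \<tau> (prod_encode (i, l))"
      have "\<rho> l = \<sigma> i l" if "l < n" for l
        using r(2) k \<open>k' \<ge> k\<close> that unfolding \<sigma>_def by (meson less_le_trans)
      then show "f i \<rho> \<in> U" using n r(1) by blast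
    qed
    then show ?thesis by blast
  qed
  \<comment> \<open>If all these values agreed with the one at index 0, that value would lie in
    every \<open>P i\<close>.\<close>
  obtain i where i: "f i (\<sigma> i) \<noteq> f 0 (\<sigma> 0)"
  proof (rule ccontr)
    assume "\<not> thesis"
    then have "f i (\<sigma> i) = f 0 (\<sigma> 0)" for i using that by blast
    then have "f 0 (\<sigma> 0) \<in> P i" for i using C(3) sC by (metis imageI)
    then show False using empty by blast
  qed
  obtain U V where UV: "open U" "open V" "f i (\<sigma> i) \<in> U" "f 0 (\<sigma> 0) \<in> V" "U \<inter> V = {}"
    using hausdorff[OF i] by blast
  obtain k1 where "\<forall>k'\<ge>k1. Q \<tau> k' i \<subseteq> U" using near[OF UV(1,3)] by blast
  moreover obtain k2 where "\<forall>k'\<ge>k2. Q \<tau> k' 0 \<subseteq> V" using near[OF UV(2,4)] by blast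
  ultimately have k: "Q \<tau> (max k1 k2) i \<subseteq> U" "Q \<tau> (max k1 k2) 0 \<subseteq> V" by auto
  have "i \<noteq> 0" using i by metis
  then have "borel_separable (Q \<tau> (max k1 k2))" unfolding borel_separable_def
    using k UV(1,2,5) by (intro exI[of _ "(\<lambda>_. UNIV)(i := U, 0 := V)"]) (auto split: if_splits)
  then show False using nQ by blast
qed

text \<open>Novikov's theorem is applied to \<open>P, Q, Q, ...\<close>: since \<open>Q\<close> lies
  in every hull after the first, \<open>B 0 \<inter> Q\<close> lies in the empty
  intersection.\<close>

corollary lusin_separation:
  fixes P Q :: "'b::t2_space set"
  assumes "analytic_set P" "analytic_set Q" "P \<inter> Q = {}"
  obtains B where "B \<in> sets borel" "P \<subseteq> B" "B \<inter> Q = {}"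
proof -
  have "borel_separable (case_nat P (\<lambda>_. Q))"
  proof (rule novikov_separation)
    show "analytic_set (case i of 0 \<Rightarrow> P | Suc _ \<Rightarrow> Q)" for i using assms by (cases i) auto
    have "(\<Inter>i. case i of 0 \<Rightarrow> P | Suc _ \<Rightarrow> Q) \<subseteq> (case 0 of 0 \<Rightarrow> P | Suc _ \<Rightarrow> Q) \<inter> (case Suc 0 of 0 \<Rightarrow> P | Suc _ \<Rightarrow> Q)"
      by blast
    then show "(\<Inter>i. case i of 0 \<Rightarrow> P | Suc _ \<Rightarrow> Q) = {}" using assms(3) by simp
  qed
  then obtain B where B: "\<And>i. B i \<in> sets borel" "\<And>i. (case i of 0 \<Rightarrow> P | Suc _ \<Rightarrow> Q) \<subseteq> B i" "(\<Inter>i. B i) = {}"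
    unfolding borel_separable_def by blast
  have "P \<subseteq> B 0" using B(2)[of 0] by simp
  moreover have "Q \<subseteq> B (Suc i)" for i using B(2)[of "Suc i"] by simp
  then have "B 0 \<inter> Q \<subseteq> B i" for i by (cases i) auto
  then have "B 0 \<inter> Q = {}" using B(3) by blast
  ultimately show ?thesis using that B(1) by blast
qed

section \<open>Borel projections\<close>

instance prod :: (polish_space, polish_space) polish_space ..

lemma analytic_set_fst_image:
  fixes A :: "('b::polish_space \<times> 'c::polish_space) set"
  assumes "A \<in> sets borel"
  shows "analytic_set (fst ` A)"
  by (intro analytic_set_image analytic_set_borel assms continuous_on_fst continuous_on_id)

text \<open>Over its projection, \<open>A\<close> is the graph of a function, which Borel functions
  \<open>g n\<close> approximate to within \<open>(1/2)^n\<close>; their limit \<open>h\<close> is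
  Borel. The projection is then the preimage of \<open>A\<close> under
  \<open>x \<mapsto> (x, h x)\<close>, cut down to the domain of convergence.\<close>

lemma borel_fst_image_single_valued:
  fixes A :: "('b::polish_space \<times> 'c::polish_space) set"
  assumes A: "A \<in> sets borel"
    and single: "\<And>x y z. (x, y) \<in> A \<Longrightarrow> (x, z) \<in> A \<Longrightarrow> y = z"
  shows "fst ` A \<in> sets borel"
proof -
  obtain Q :: "'c set" where Q: "countable Q" "\<And>X. open X \<Longrightarrow> X \<noteq> {} \<Longrightarrow> \<exists>d\<in>Q. d \<in> X"
    by (rule countable_dense_setE) blast
  have "Q \<noteq> {}" using Q(2)[of UNIV] by auto
  then have rq: "range (from_nat_into Q) = Q" using Q(1) by (rule range_from_nat_into)
  define q where "q = from_nat_into Q"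
  have dense: "\<exists>i. dist (q i) y < e" if "e > 0" for y e
  proof -
    have "\<exists>d\<in>Q. d \<in> ball y e" using Q(2)[of "ball y e"] that by auto
    then obtain d where "d \<in> Q" "dist d y < e" by (auto simp: dist_commute)
    then show ?thesis using rq unfolding q_def by (metis rangeE)
  qed
  \<comment> \<open>\<open>near n i\<close> is the part of \<open>A\<close> whose second coordinate is close to \<open>q i\<close>; separating it from the
    rest of \<open>A\<close> lets one read off an approximate second coordinate from the first one.\<close>
  define near where "near n i = A \<inter> snd -` ball (q i) ((1/2)^n)" for n i
  have near_borel: "near n i \<in> sets borel" for n i
  proof -
    have "snd -` ball (q i) ((1/2)^n) \<in> sets (borel :: ('b \<times> 'c) measure)"
      by (intro borel_open open_vimage_snd open_ball)
    then show ?thesis using A by (auto simp: near_def)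
  qed
  have "\<exists>B. B \<in> sets borel \<and> fst ` near n i \<subseteq> B \<and> B \<inter> fst ` (A - near n i) = {}" for n i
  proof -
    have "fst ` near n i \<inter> fst ` (A - near n i) = {}"
      using single unfolding near_def by fastforce
    moreover have "analytic_set (fst ` near n i)" "analytic_set (fst ` (A - near n i))"
      using near_borel A by (auto intro!: analytic_set_fst_image)
    ultimately show ?thesis using lusin_separation by metis
  qed
  then obtain B where B: "\<And>n i. B n i \<in> sets borel" "\<And>n i. fst ` near n i \<subseteq> B n i"
    "\<And>n i. B n i \<inter> fst ` (A - near n i) = {}" by metis
  \<comment> \<open>Where no hull contains \<open>x\<close> the least index is arbitrary; this does
    no harm, as the estimate concerns points of the projection of \<open>A\<close> only.\<close>
  define g where "g n x = q (LEAST i. x \<in> B n i)" for n x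
  have [measurable]: "B n i \<in> sets borel" for n i by (rule B(1))
  have g[measurable]: "g n \<in> borel_measurable borel" for n
  proof -
    have "(\<lambda>x. LEAST i. x \<in> B n i) \<in> measurable borel (count_space UNIV)" by measurable
    then show ?thesis unfolding g_def by (rule measurable_compose) simp
  qed
  have gA: "dist (g n x) y < (1/2)^n" if "(x, y) \<in> A" for n x y
  proof -
    obtain i where "dist (q i) y < (1/2)^n" using dense[of "(1/2)^n" y] by auto
    then have "(x, y) \<in> near n i" using that by (auto simp: near_def)
    then have "x \<in> B n i" using B(2)[of n i] by force
    then have "x \<in> B n (LEAST i. x \<in> B n i)" by (rule LeastI)
    then have "x \<notin> fst ` (A - near n (LEAST i. x \<in> B n i))" using B(3) by blast
    then have "(x, y) \<in> near n (LEAST i. x \<in> B n i)" using that by force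
    then show ?thesis by (simp add: near_def g_def)
  qed
  have limA: "(\<lambda>n. g n x) \<longlonglongrightarrow> y" if "(x, y) \<in> A" for x y
  proof -
    have "(\<lambda>n. dist (g n x) y) \<longlonglongrightarrow> 0"
    proof (rule tendsto_sandwich[OF _ _ tendsto_const])
      show "(\<lambda>n. (1/2::real)^n) \<longlonglongrightarrow> 0" by (intro LIMSEQ_power_zero) auto
      show "\<forall>\<^sub>F n in sequentially. dist (g n x) y \<le> (1/2)^n"
        by (intro always_eventually allI less_imp_le gA[OF that])
    qed simp
    then show ?thesis by (rule tendsto_dist_iff[THEN iffD2])
  qed
  define D where "D = {x \<in> space borel. Cauchy (\<lambda>n. g n x)}"
  have D[measurable]: "D \<in> sets borel" unfolding D_def by measurable
  \<comment> \<open>The default \<open>q 0\<close> off \<open>D\<close> makes \<open>h\<close> an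
    everywhere defined pointwise limit of measurable functions.\<close>
  define h where "h x = (if x \<in> D then lim (\<lambda>n. g n x) else q 0)" for x
  have h[measurable]: "h \<in> borel_measurable borel"
  proof (rule borel_measurable_LIMSEQ_metric)
    show "(\<lambda>x. if x \<in> D then g n x else q 0) \<in> borel_measurable borel" for n by measurable
    show "(\<lambda>n. if x \<in> D then g n x else q 0) \<longlonglongrightarrow> h x" for x
    proof (cases "x \<in> D")
      case True
      then have "convergent (\<lambda>n. g n x)" using Cauchy_convergent by (auto simp: D_def)
      then show ?thesis using True by (simp add: h_def convergent_LIMSEQ_iff)
    qed (simp add: h_def)
  qed
  have "fst ` A = {x \<in> space borel. x \<in> D \<and> (x, h x) \<in> A}"
  proof safe
    fix x y assume xy: "(x, y) \<in> A"
    have D: "x \<in> D" using LIMSEQ_imp_Cauchy[OF limA[OF xy]] by (simp add: D_def)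
    then have "h x = y" using limI[OF limA[OF xy]] by (simp add: h_def)
    then show "fst (x, y) \<in> D" "(fst (x, y), h (fst (x, y))) \<in> A" using D xy by auto
  qed (force simp: )+
  also have "\<dots> \<in> sets borel"
  proof -
    have "(\<lambda>x. (x, h x)) \<in> borel_measurable borel" by (intro borel_measurable_Pair) measurable
    then have "(\<lambda>x. (x, h x)) -` A \<inter> space borel \<in> sets borel" using A by (rule measurable_sets)
    then have "D \<inter> ((\<lambda>x. (x, h x)) -` A \<inter> space borel) \<in> sets borel" by (rule sets.Int[OF D])
    also have "D \<inter> ((\<lambda>x. (x, h x)) -` A \<inter> space borel) = {x \<in> space borel. x \<in> D \<and> (x, h x) \<in> A}"
      by auto
    finally show ?thesis .
  qed
  finally show ?thesis .
qed

text \<open>A special case of the Lusin--Novikov theorem. Every point of a finite section is isolated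
  by a basic open set, so \<open>A\<close> is covered by the coanalytic sets \<open>iso n\<close>; Novikov's theorem
  shrinks them to single-valued Borel sets that still cover \<open>A\<close>.\<close>

theorem borel_fst_image_finite_sections:
  fixes A :: "('b::polish_space \<times> 'c::polish_space) set"
  assumes A: "A \<in> sets borel" and fin: "\<And>x. finite {y. (x, y) \<in> A}"
  shows "fst ` A \<in> sets borel"
proof -
  obtain \<U> :: "'c set set" where U: "countable \<U>" "topological_basis \<U>"
    using ex_countable_basis by blast
  have "\<U> \<noteq> {}" using U(2) topological_basisE[OF U(2) open_UNIV UNIV_I] by blast
  then have rU: "range (from_nat_into \<U>) = \<U>" using U(1) by (rule range_from_nat_into)
  define u where "u = from_nat_into \<U>"
  have u_open: "open (u n)" for n
    using U(2) rU topological_basis_open unfolding u_def by (metis rangeI)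
  have u_basis: "\<exists>n. y \<in> u n \<and> u n \<subseteq> V" if "open V" "y \<in> V" for y V
    using topological_basisE[OF U(2) that] rU unfolding u_def by (metis rangeE)
  define iso where "iso n = {(x, y). (x, y) \<in> A \<and> y \<in> u n \<and> (\<forall>z. (x, z) \<in> A \<longrightarrow> z \<in> u n \<longrightarrow> z = y)}" for n
  have cover: "(\<Inter>n. A - iso n) = {}"
  proof -
    \<comment> \<open>The other points of a finite section form a closed set, so a basic open set
      contains \<open>y\<close> and avoids them.\<close>
    have "\<exists>n. (x, y) \<in> iso n" if xy: "(x, y) \<in> A" for x y
    proof -
      have "finite ({z. (x, z) \<in> A} - {y})" using fin by simp
      then have "open (- ({z. (x, z) \<in> A} - {y}))" by (intro open_Compl finite_imp_closed)
      then obtain n where "y \<in> u n" "u n \<subseteq> - ({z. (x, z) \<in> A} - {y})"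
        using u_basis[of "- ({z. (x, z) \<in> A} - {y})" y] by auto
      then show ?thesis using xy by (auto simp: iso_def)
    qed
    then show ?thesis by auto
  qed
  have "analytic_set (A - iso n)" for n
  proof -
    have un: "snd -` u n \<in> sets (borel :: ('b \<times> 'c) measure)"
      by (intro borel_open open_vimage_snd u_open)
    \<comment> \<open>In a triple \<open>((x, y), z)\<close>, the point \<open>z\<close> is a second
      member of the section and lies in \<open>u n\<close>. Such a \<open>z\<close> is one way for
      \<open>(x, y)\<close> to miss \<open>iso n\<close>; the other is
      \<open>y \<notin> u n\<close>.\<close>
    define T :: "(('b \<times> 'c) \<times> 'c) set" where
      "T = fst -` A \<inter> (\<lambda>p. (fst (fst p), snd p)) -` A \<inter> {p. snd (fst p) \<noteq> snd p} \<inter> snd -` u n"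
    have "(\<lambda>p. (fst (fst p), snd p)) -` A \<inter> space borel \<in> sets (borel :: (('b \<times> 'c) \<times> 'c) measure)"
      by (rule measurable_sets[OF _ A])
        (intro borel_measurable_continuous_onI continuous_intros)
    moreover have "fst -` A \<inter> space borel \<in> sets (borel :: (('b \<times> 'c) \<times> 'c) measure)"
      by (rule measurable_sets[OF _ A])
        (intro borel_measurable_continuous_onI continuous_intros)
    moreover have "{p. snd (fst p) \<noteq> snd p} \<in> sets (borel :: (('b \<times> 'c) \<times> 'c) measure)"
      by (intro borel_open open_Collect_neq continuous_intros)
    moreover have "snd -` u n \<in> sets (borel :: (('b \<times> 'c) \<times> 'c) measure)"
      by (intro borel_open open_vimage_snd u_open)
    ultimately have "T \<in> sets borel" unfolding T_def by (intro sets.Int) auto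
    then have "analytic_set (fst ` T)" by (rule analytic_set_fst_image)
    moreover have "analytic_set (A - snd -` u n)" using A un by (intro analytic_set_borel) auto
    ultimately have "analytic_set (\<Union>i::nat. if i = 0 then fst ` T else A - snd -` u n)"
      by (intro analytic_set_UN) auto
    also have "(\<Union>i::nat. if i = 0 then fst ` T else A - snd -` u n) = fst ` T \<union> (A - snd -` u n)"
      by (auto split: if_splits)
    also have "fst ` T = {(x, y). (x, y) \<in> A \<and> (\<exists>z\<in>u n. (x, z) \<in> A \<and> y \<noteq> z)}"
    proof -
      have "fst ` T = {p. \<exists>z. (p, z) \<in> T}" by force
      then show ?thesis by (auto simp: T_def)
    qed
    also have "\<dots> \<union> (A - snd -` u n) = A - iso n"
    proof (rule set_eqI)
      show "p \<in> {(x, y). (x, y) \<in> A \<and> (\<exists>z\<in>u n. (x, z) \<in> A \<and> y \<noteq> z)} \<union> (A - snd -` u n)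
        \<longleftrightarrow> p \<in> A - iso n" for p
        by (cases p) (simp add: iso_def, blast)
    qed
    finally show ?thesis .
  qed
  from novikov_separation[OF this cover]
  obtain B where B: "\<And>n. B n \<in> sets borel" "\<And>n. A - iso n \<subseteq> B n" "(\<Inter>n. B n) = {}"
    unfolding borel_separable_def by blast
  \<comment> \<open>Outside the hull \<open>B n\<close> only points of \<open>iso n\<close> remain,
    and as the hulls have empty intersection these remainders cover \<open>A\<close>.\<close>
  have "fst ` (A - B n) \<in> sets borel" for n
  proof (rule borel_fst_image_single_valued)
    show "A - B n \<in> sets borel" using A B(1) by blast
    have "A - B n \<subseteq> iso n" using B(2)[of n] by blast
    then show "y = z" if "(x, y) \<in> A - B n" "(x, z) \<in> A - B n" for x y z
      using that unfolding iso_def by blast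
  qed
  then have "(\<Union>n. fst ` (A - B n)) \<in> sets borel" by blast
  also have "(\<Union>n. fst ` (A - B n)) = fst ` (A - (\<Inter>n. B n))" by blast
  also have "\<dots> = fst ` A" by (simp only: B(3) Diff_empty)
  finally show ?thesis .
qed

section \<open>Standard Borel spaces\<close>

text \<open>Carries the measurable structure over to a type of class \<^class>\<open>polish_space\<close>, where analytic
  sets are available.\<close>

definition polish_embedding :: "'a measure \<Rightarrow> ('a \<Rightarrow> 'b::polish_space) \<Rightarrow> bool" where
  "polish_embedding N \<phi> \<longleftrightarrow>
     inj_on \<phi> (space N) \<and> \<phi> \<in> borel_measurable N \<and> (\<forall>A\<in>sets N. \<phi> ` A \<in> sets borel)"

text \<open>Injectivity makes images commute with differences, and \<open>K\<close> contains the
  image of \<open>X\<close>; so complements are carried across and only generators have to be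
  checked.\<close>

lemma image_sigma_sets:
  assumes "A \<in> sigma_sets X G" "G \<subseteq> Pow X" "inj_on \<phi> X"
    and "\<phi> ` X \<in> sets K" "\<And>g. g \<in> G \<Longrightarrow> \<phi> ` g \<in> sets K"
  shows "\<phi> ` A \<in> sets K"
  using assms(1)
proof induction
  case (Compl a)
  have "a \<subseteq> X" using Compl(1) assms(2) sigma_sets_into_sp by metis
  then have "\<phi> ` (X - a) = \<phi> ` X - \<phi> ` a" using assms(3) by (auto simp: inj_on_def)
  then show ?case using Compl assms(4) by simp
next
  case (Union a)
  then show ?case by (simp add: image_UN)
qed (use assms in auto)

lemma gdelta_in_borel:
  assumes "gdelta_in euclidean S"
  shows "S \<in> sets borel"
proof -
  obtain \<U> where "countable \<U>" "\<And>U. U \<in> \<U> \<Longrightarrow> open U" "\<Inter>\<U> = S"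
    using assms unfolding gdelta_in_alt intersection_of_def by (auto simp: subset_iff)
  then have "(\<Inter>U\<in>\<U>. U) \<in> sets borel" by (intro sets.countable_INT'') (auto simp: borel_open)
  then show ?thesis using \<open>\<Inter>\<U> = S\<close> by simp
qed

text \<open>Distances to a dense sequence embed the space homeomorphically into a countable power of
  the reals. Complete metrizability makes the image a G-delta set, so images of open sets are Borel,
  and with them images of all measurable sets.\<close>

lemma standard_borel_polish_embedding:
  fixes M :: "'a measure"
  assumes "standard_borel M"
  obtains \<phi> :: "'a \<Rightarrow> nat \<Rightarrow> real" where "polish_embedding M \<phi>"
proof (cases "space M = {}")
  \<comment> \<open>An empty space has no sequence of points to measure distances from.\<close>
  case True
  have "A = {}" if "A \<in> sets M" for A
    using sets.sets_into_space[OF that] True by simp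
  then have "polish_embedding M (\<lambda>_ _. 0 :: real)"
    by (auto simp: polish_embedding_def True image_constant_conv)
  then show ?thesis by (rule that)
next
  case False
  obtain T where T: "topspace T = space M" "completely_metrizable_space T" "separable_space T"
    "sets M = sigma_sets (space M) {U. openin T U}"
    using assms unfolding standard_borel_def by blast
  obtain X d where X: "Metric_space X d" "T = Metric_space.mtopology X d"
    using T(2) unfolding completely_metrizable_space_def by blast
  interpret Metric_space X d by (rule X(1))
  have XM: "X = space M" using T(1) X(2) by simp
  obtain Q where Q: "countable Q" "Q \<subseteq> X" "mtopology closure_of Q = X"
    using T(3) X(2) unfolding separable_space_def by auto
  have "Q \<noteq> {}" using Q(3) False XM by auto
  then have rq: "range (from_nat_into Q) = Q" using Q(1) by (rule range_from_nat_into)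
  define q where "q = from_nat_into Q"
  have qX: "q n \<in> X" for n using rq Q(2) unfolding q_def by blast
  have dense: "\<exists>n. d x (q n) < e" if "x \<in> X" "e > 0" for x e
  proof -
    have "x \<in> mtopology closure_of Q" using Q(3) that by simp
    then obtain y where "y \<in> Q" "d x y < e" using \<open>e > 0\<close> unfolding metric_closure_of by auto
    then show ?thesis using rq unfolding q_def by (metis rangeE)
  qed
  define \<phi> where "\<phi> x = (\<lambda>n. d x (q n))" for x
  have inj: "inj_on \<phi> X"
  proof (rule inj_onI, rule ccontr)
    fix x y assume xy: "x \<in> X" "y \<in> X" "\<phi> x = \<phi> y" "x \<noteq> y"
    then obtain n where n: "d x (q n) < d x y / 2" using dense[of x "d x y / 2"] by auto
    have "d x (q n) = d y (q n)" using fun_cong[OF xy(3), of n] by (simp add: \<phi>_def)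
    then show False using n triangle'[of x "q n" y] xy qX by (simp add: commute)
  qed
  define Y where "Y = top_of_set (\<phi> ` X)"
  have cont: "continuous_map mtopology euclidean \<phi>"
  proof -
    have "continuous_map mtopology euclideanreal (\<lambda>x. d x (q n))" for n
    proof -
      have "\<bar>d a (q n) - d x (q n)\<bar> \<le> d a x" if "a \<in> X" "x \<in> X" for a x
        using triangle[OF that qX[of n]] triangle[OF that(2,1) qX[of n]] commute[of a x] by simp
      then have "dist (d a (q n)) (d x (q n)) < \<epsilon>" if "a \<in> X" "x \<in> X" "d a x < \<epsilon>" for a x \<epsilon>
        using that by (fastforce simp: dist_real_def)
      then show ?thesis
        using metric_continuous_map[OF Met_TC.Metric_space_axioms, of "\<lambda>x. d x (q n)"] by auto
    qed
    then have "continuous_map mtopology (powertop_real UNIV) \<phi>"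
      unfolding \<phi>_def by (subst continuous_map_componentwise_UNIV) auto
    then show ?thesis by (simp add: euclidean_product_topology)
  qed
  have opn: "openin Y (\<phi> ` U)" if U: "openin mtopology U" for U
  proof -
    \<comment> \<open>\<open>V\<close> collects the conditions \<open>v n < e\<close> for which the
      ball of radius \<open>e\<close> around \<open>q n\<close> stays inside \<open>U\<close>; by
      density such balls cover \<open>U\<close>.\<close>
    define V where "V = (\<Union>(n, e) \<in> {(n, e). \<forall>y\<in>X. d y (q n) < e \<longrightarrow> y \<in> U}. {v :: nat \<Rightarrow> real. v n < e})"
    have "open V" unfolding V_def
      by (intro open_UN ballI) (auto intro!: open_Collect_less continuous_on_const)
    moreover have "\<phi> ` U = \<phi> ` X \<inter> V"
    proof safe
      fix x assume x: "x \<in> U"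
      then have xX: "x \<in> X" using openin_subset[OF U] by auto
      then show "\<phi> x \<in> \<phi> ` X" by simp
      obtain r where r: "r > 0" "mball x r \<subseteq> U" using U x unfolding openin_mtopology by blast
      obtain n where n: "d x (q n) < r / 2" using dense[OF xX, of "r / 2"] r(1) by auto
      have "y \<in> U" if "y \<in> X" "d y (q n) < r / 2" for y
      proof -
        have "d x y < r" using triangle'[of x "q n" y] n that xX qX[of n] by simp
        then show ?thesis using r(2) that(1) xX by auto
      qed
      then show "\<phi> x \<in> V" using n unfolding V_def \<phi>_def by (intro UN_I[of "(n, r / 2)"]) auto
    next
      fix x assume "x \<in> X" "\<phi> x \<in> V"
      then have "x \<in> U" unfolding V_def \<phi>_def by auto
      then show "\<phi> x \<in> \<phi> ` U" by simp
    qed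
    ultimately show ?thesis unfolding Y_def by (simp add: openin_open_Int)
  qed
  have "homeomorphic_map mtopology Y \<phi>"
  proof (rule bijective_open_imp_homeomorphic_map)
    show "continuous_map mtopology Y \<phi>" using cont by (simp add: Y_def continuous_map_in_subtopology)
    show "open_map mtopology Y \<phi>" using opn by (simp add: open_map_def)
  qed (auto simp: Y_def inj)
  then have "completely_metrizable_space Y"
    using T(2) X(2) homeomorphic_completely_metrizable_space homeomorphic_map_imp_homeomorphic_space by blast
  then have "gdelta_in euclidean (\<phi> ` X)"
    unfolding Y_def
    by (intro completely_metrizable_space_imp_gdelta_in metrizable_space_euclidean) auto
  then have imX: "\<phi> ` X \<in> sets borel" by (rule gdelta_in_borel)
  have "\<phi> ` A \<in> sets borel" if "A \<in> sets M" for A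
  proof (rule image_sigma_sets[where K = borel])
    show "A \<in> sigma_sets X {U. openin mtopology U}" using that T(4) X(2) XM by simp
    show "{U. openin mtopology U} \<subseteq> Pow X" using openin_subset by fastforce
    fix U assume "U \<in> {U. openin mtopology U}"
    then have "openin (top_of_set (\<phi> ` X)) (\<phi> ` U)" using opn by (simp add: Y_def)
    then obtain V where "open V" "\<phi> ` U = \<phi> ` X \<inter> V" by (auto simp: openin_open)
    then show "\<phi> ` U \<in> sets borel" using imX by (simp add: borel_open sets.Int)
  qed (use inj imX in auto)
  moreover have "\<phi> \<in> borel_measurable M"
  proof (rule borel_measurableI)
    fix V :: "(nat \<Rightarrow> real) set" assume "open V"
    then have "openin mtopology {x \<in> topspace mtopology. \<phi> x \<in> V}"
      by (intro openin_continuous_map_preimage[OF cont]) simp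
    moreover have "{x \<in> topspace mtopology. \<phi> x \<in> V} = \<phi> -` V \<inter> space M"
      using XM topspace_mtopology by blast
    ultimately show "\<phi> -` V \<inter> space M \<in> sets M" using T(4) X(2) by auto
  qed
  ultimately have "polish_embedding M \<phi>" using inj XM by (simp add: polish_embedding_def)
  then show ?thesis by (rule that)
qed

text \<open>Rectangles generate the product, so images are checked on them alone, and
  \<open>borel_prod\<close> makes a product of Borel sets Borel in the product space.\<close>

lemma polish_embedding_pair:
  assumes "polish_embedding N \<phi>" "polish_embedding M \<psi>"
  shows "polish_embedding (N \<Otimes>\<^sub>M M) (map_prod \<phi> \<psi>)"
proof -
  have inj: "inj_on (map_prod \<phi> \<psi>) (space N \<times> space M)"
    using assms by (auto simp: polish_embedding_def intro: map_prod_inj_on)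
  have rect: "map_prod \<phi> \<psi> ` (a \<times> b) \<in> sets borel" if "a \<in> sets N" "b \<in> sets M" for a b
  proof -
    have "\<phi> ` a \<times> \<psi> ` b \<in> sets (borel \<Otimes>\<^sub>M borel)"
      using assms that by (intro pair_measureI) (auto simp: polish_embedding_def)
    then show ?thesis by (simp only: borel_prod map_prod_surj_on[OF refl refl])
  qed
  have "map_prod \<phi> \<psi> ` A \<in> sets borel" if "A \<in> sets (N \<Otimes>\<^sub>M M)" for A
  proof (rule image_sigma_sets[OF _ _ inj])
    show "A \<in> sigma_sets (space N \<times> space M) {a \<times> b | a b. a \<in> sets N \<and> b \<in> sets M}"
      using that by (simp only: sets_pair_measure)
    show "{a \<times> b | a b. a \<in> sets N \<and> b \<in> sets M} \<subseteq> Pow (space N \<times> space M)"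
      by (auto dest: sets.sets_into_space)
    show "map_prod \<phi> \<psi> ` (space N \<times> space M) \<in> sets borel" by (intro rect sets.top)
  qed (use rect in blast)
  moreover have "map_prod \<phi> \<psi> \<in> borel_measurable (N \<Otimes>\<^sub>M M)"
  proof -
    have [measurable]: "\<phi> \<in> borel_measurable N" "\<psi> \<in> borel_measurable M"
      using assms by (auto simp: polish_embedding_def)
    have "(\<lambda>p. (\<phi> (fst p), \<psi> (snd p))) \<in> borel_measurable (N \<Otimes>\<^sub>M M)"
      by (intro borel_measurable_Pair) measurable
    then show ?thesis by (simp add: map_prod_def case_prod_beta')
  qed
  ultimately show ?thesis using inj by (simp add: polish_embedding_def space_pair_measure)
qed

section \<open>Quantifiers over finite sections\<close>

lemma sets_fst_image_finite_sections:
  assumes emb: "polish_embedding N \<phi>" "polish_embedding M \<psi>"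
    and A: "A \<in> sets (N \<Otimes>\<^sub>M M)" and fin: "\<And>x. finite {y. (x, y) \<in> A}"
  shows "fst ` A \<in> sets N"
proof -
  have sub: "A \<subseteq> space N \<times> space M" using sets.sets_into_space[OF A] by (simp add: space_pair_measure)
  have inj: "inj_on \<phi> (space N)" and meas: "\<phi> \<in> borel_measurable N"
    using emb(1) by (auto simp: polish_embedding_def)
  have "map_prod \<phi> \<psi> ` A \<in> sets borel"
    using polish_embedding_pair[OF emb] A by (simp add: polish_embedding_def)
  moreover have "finite {y. (x, y) \<in> map_prod \<phi> \<psi> ` A}" for x
  proof (cases "\<exists>x0\<in>space N. \<phi> x0 = x")
    case True
    then obtain x0 where x0: "x0 \<in> space N" "\<phi> x0 = x" by blast
    have "{y. (x, y) \<in> map_prod \<phi> \<psi> ` A} \<subseteq> \<psi> ` {y. (x0, y) \<in> A}"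
    proof (intro subsetI)
      fix y assume "y \<in> {y. (x, y) \<in> map_prod \<phi> \<psi> ` A}"
      then obtain a b where ab: "(a, b) \<in> A" "\<phi> a = x" "\<psi> b = y" by auto
      then have "a = x0" using sub x0 inj by (auto simp: inj_on_def)
      then show "y \<in> \<psi> ` {y. (x0, y) \<in> A}" using ab by auto
    qed
    then show ?thesis using fin finite_subset by blast
  next
    case False
    then have "{y. (x, y) \<in> map_prod \<phi> \<psi> ` A} = {}" using sub by fastforce
    then show ?thesis by simp
  qed
  ultimately have "fst ` map_prod \<phi> \<psi> ` A \<in> sets borel"
    by (rule borel_fst_image_finite_sections)
  also have "fst ` map_prod \<phi> \<psi> ` A = \<phi> ` fst ` A" by (simp add: image_image)
  finally have "\<phi> -` (\<phi> ` fst ` A) \<inter> space N \<in> sets N" using meas by (rule measurable_sets[rotated])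
  also have "\<phi> -` (\<phi> ` fst ` A) \<inter> space N = fst ` A"
  proof (intro equalityI subsetI)
    fix x assume "x \<in> \<phi> -` (\<phi> ` fst ` A) \<inter> space N"
    then obtain p where p: "p \<in> A" "\<phi> x = \<phi> (fst p)" "x \<in> space N" by auto
    moreover have "fst p \<in> space N" using p(1) sub by auto
    ultimately have "x = fst p" using inj by (auto dest: inj_onD)
    then show "x \<in> fst ` A" using p(1) by simp
  qed (use sub in auto)
  finally show ?thesis .
qed

text \<open>This is the projection theorem in the form used below: an existential quantifier over a
  finite section preserves measurability.\<close>

lemma sets_Collect_Bex_finite:
  assumes "polish_embedding N \<phi>" "polish_embedding M \<psi>"
    and A: "{p \<in> space (N \<Otimes>\<^sub>M M). P (fst p) (snd p)} \<in> sets (N \<Otimes>\<^sub>M M)"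
    and fin: "\<And>x. x \<in> space N \<Longrightarrow> finite {y \<in> space M. P x y}"
  shows "{x \<in> space N. \<exists>y\<in>space M. P x y} \<in> sets N"
proof -
  have "finite {y. (x, y) \<in> {p \<in> space (N \<Otimes>\<^sub>M M). P (fst p) (snd p)}}" for x
    using fin[of x] by (cases "x \<in> space N") (auto simp: space_pair_measure)
  from sets_fst_image_finite_sections[OF assms(1,2) A this] show ?thesis
    by (rule back_subst[where P = "\<lambda>A. A \<in> sets N"]) (force simp: space_pair_measure)
qed

text \<open>For an equivalence relation \<open>E\<close>, the condition compares which classes of
  \<open>E\<close> the two sections meet. It serves twice: with \<open>S\<close> the previous
  relation when coarsening, and with \<open>S\<close> a relation of balls when building the finite
  relations.\<close>

definition section_equiv :: "'a set \<Rightarrow> 'a rel \<Rightarrow> 'a rel \<Rightarrow> 'a rel" where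
  "section_equiv X S E = {(x, y) \<in> X \<times> X. E `` (S `` {x}) = E `` (S `` {y})}"

lemma equiv_section_equiv: "equiv X (section_equiv X S E)"
  by (auto simp: section_equiv_def intro!: equivI refl_onI symI transI)

text \<open>Equality of saturations amounts to two inclusions, each of the form \<forall>\<exists>
  with both quantifiers running over finite sections of \<open>S\<close>; hence two projections
  suffice for each.\<close>

lemma borel_equiv_section_equiv:
  fixes M :: "'a measure"
  assumes sb: "standard_borel M"
    and E: "borel_equiv M E" and S: "S \<in> sets (M \<Otimes>\<^sub>M M)"
    and fin: "\<And>x. finite (S `` {x})"
  shows "borel_equiv M (section_equiv (space M) S E)"
proof -
  obtain \<phi> :: "'a \<Rightarrow> nat \<Rightarrow> real" where \<phi>: "polish_embedding M \<phi>"
    using standard_borel_polish_embedding[OF sb] .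
  note \<phi>2 = polish_embedding_pair[OF \<phi> \<phi>]
  have [measurable]: "S \<in> sets (M \<Otimes>\<^sub>M M)" "E \<in> sets (M \<Otimes>\<^sub>M M)" using S E by (auto simp: borel_equiv_def)
  have eqE: "equiv (space M) E" using E by (simp add: borel_equiv_def)
  have SX: "S \<subseteq> space M \<times> space M" using sets.sets_into_space[OF S] by (simp add: space_pair_measure)
  have EX: "E \<subseteq> space M \<times> space M" using eqE by (simp add: equiv_def refl_on_def)
  have fin': "finite {y \<in> space M. (x, y) \<in> S \<and> Q y}" for x Q
    by (rule finite_subset[OF _ fin[of x]]) auto
  \<comment> \<open>A pair \<open>(z, y)\<close> is in \<open>T\<close> when \<open>z\<close> lies
    in the \<open>E\<close>-saturation of the section at \<open>y\<close>.\<close>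
  define T where "T = {p \<in> space (M \<Otimes>\<^sub>M M). \<exists>w\<in>space M. (snd p, w) \<in> S \<and> (w, fst p) \<in> E}"
  have [measurable]: "T \<in> sets (M \<Otimes>\<^sub>M M)" unfolding T_def
  proof (rule sets_Collect_Bex_finite[OF \<phi>2 \<phi>])
    show "{p \<in> space ((M \<Otimes>\<^sub>M M) \<Otimes>\<^sub>M M). (snd (fst p), snd p) \<in> S \<and> (snd p, fst (fst p)) \<in> E} \<in> sets ((M \<Otimes>\<^sub>M M) \<Otimes>\<^sub>M M)"
      by measurable
  qed (rule fin')
  \<comment> \<open>The failure of the inclusion is recorded, since projections produce existential
    quantifiers.\<close>
  define L where "L = {p \<in> space (M \<Otimes>\<^sub>M M). \<exists>z\<in>space M. (fst p, z) \<in> S \<and> (z, snd p) \<notin> T}"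
  have L[measurable]: "L \<in> sets (M \<Otimes>\<^sub>M M)" unfolding L_def
  proof (rule sets_Collect_Bex_finite[OF \<phi>2 \<phi>])
    show "{p \<in> space ((M \<Otimes>\<^sub>M M) \<Otimes>\<^sub>M M). (fst (fst p), snd p) \<in> S \<and> (snd p, snd (fst p)) \<notin> T} \<in> sets ((M \<Otimes>\<^sub>M M) \<Otimes>\<^sub>M M)"
      by measurable
  qed (rule fin')
  have L_iff: "(x, y) \<notin> L \<longleftrightarrow> E `` (S `` {x}) \<subseteq> E `` (S `` {y})" if xy: "x \<in> space M" "y \<in> space M" for x y
  proof -
    have "(x, y) \<notin> L \<longleftrightarrow> (\<forall>z. (x, z) \<in> S \<longrightarrow> (\<exists>w. (y, w) \<in> S \<and> (w, z) \<in> E))"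
      using xy SX unfolding L_def T_def by (auto simp: space_pair_measure) blast
    also have "\<dots> \<longleftrightarrow> S `` {x} \<subseteq> E `` (S `` {y})" by blast
    also have "\<dots> \<longleftrightarrow> E `` (S `` {x}) \<subseteq> E `` (S `` {y})"
    proof
      assume "S `` {x} \<subseteq> E `` (S `` {y})"
      then have "E `` (S `` {x}) \<subseteq> E `` (E `` (S `` {y}))" by blast
      also have "\<dots> \<subseteq> E `` (S `` {y})" using equivE[OF eqE] by (metis Image_mono order_refl relcomp_Image trans_O_subset)
      finally show "E `` (S `` {x}) \<subseteq> E `` (S `` {y})" .
    next
      assume a: "E `` (S `` {x}) \<subseteq> E `` (S `` {y})"
      have "S `` {x} \<subseteq> E `` (S `` {x})" using SX equiv_class_self[OF eqE] by blast
      then show "S `` {x} \<subseteq> E `` (S `` {y})" using a by blast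
    qed
    finally show ?thesis .
  qed
  have "(x, y) \<in> section_equiv (space M) S E \<longleftrightarrow> (x, y) \<notin> L \<and> (y, x) \<notin> L"
    if "x \<in> space M" "y \<in> space M" for x y
    using that by (simp only: L_iff section_equiv_def) blast
  moreover have "section_equiv (space M) S E \<subseteq> space M \<times> space M" by (auto simp: section_equiv_def)
  ultimately have "section_equiv (space M) S E = {p \<in> space (M \<Otimes>\<^sub>M M). (fst p, snd p) \<notin> L \<and> (snd p, fst p) \<notin> L}"
    by (auto simp: space_pair_measure)
  also have "\<dots> \<in> sets (M \<Otimes>\<^sub>M M)" by measurable
  finally show ?thesis by (simp add: borel_equiv_def equiv_section_equiv)
qed

section \<open>Asymptotic dimension\<close>

locale borel_proper_space =
  fixes M :: "'a measure" and \<rho> :: "'a \<Rightarrow> 'a \<Rightarrow> ennreal"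
  assumes standard_borel: "standard_borel M"
    and extended_metric: "extended_metric_on (space M) \<rho>"
    and measurable_metric: "(\<lambda>(x, y). \<rho> x y) \<in> borel_measurable (M \<Otimes>\<^sub>M M)"
    and proper: "proper_on (space M) \<rho>"
begin

lemma metric_refl: "x \<in> space M \<Longrightarrow> \<rho> x x = 0"
  using extended_metric by (auto simp: extended_metric_on_def)

lemma metric_sym: "x \<in> space M \<Longrightarrow> y \<in> space M \<Longrightarrow> \<rho> x y = \<rho> y x"
  using extended_metric by (auto simp: extended_metric_on_def)

lemma metric_triangle:
  "x \<in> space M \<Longrightarrow> y \<in> space M \<Longrightarrow> z \<in> space M \<Longrightarrow> \<rho> x z \<le> \<rho> x y + \<rho> y z"
  using extended_metric by (auto simp: extended_metric_on_def)

lemma finite_ball: "x \<in> space M \<Longrightarrow> finite (ext_cball (space M) \<rho> x r)"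
  using proper by (auto simp: proper_on_def)

lemma measurable_metric'[measurable (raw)]:
  assumes "f \<in> measurable N M" "g \<in> measurable N M"
  shows "(\<lambda>p. \<rho> (f p) (g p)) \<in> borel_measurable N"
  using measurable_compose[OF measurable_Pair[OF assms] measurable_metric] by simp

text \<open>The bound is a real number, and \<open>0 \<le> D\<close> keeps \<open>ennreal\<close>
  additive when bounds are summed.\<close>

definition bounded_rel :: "'a rel \<Rightarrow> real \<Rightarrow> bool" where
  "bounded_rel F D \<longleftrightarrow> 0 \<le> D \<and> (\<forall>(x, y)\<in>F. \<rho> x y \<le> ennreal D)"

text \<open>Balls are finite by properness, so \<open>card\<close> is a true count for
  \<open>x\<close> in the space.\<close>

definition ball_count :: "'a rel \<Rightarrow> 'a \<Rightarrow> real \<Rightarrow> nat" where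
  "ball_count F x r = card ((\<lambda>y. F `` {y}) ` ext_cball (space M) \<rho> x r)"

lemma finite_section_bounded_rel:
  assumes "bounded_rel F D" "F \<subseteq> space M \<times> space M"
  shows "finite (F `` {x})"
proof (cases "x \<in> space M")
  case True
  have "F `` {x} \<subseteq> ext_cball (space M) \<rho> x D"
    using assms by (auto simp: bounded_rel_def ext_cball_def)
  then show ?thesis using finite_ball[OF True] finite_subset by blast
next
  case False
  then have "F `` {x} = {}" using assms(2) by auto
  then show ?thesis by simp
qed

lemma borel_equivD:
  assumes "borel_equiv M F"
  shows "equiv (space M) F" "F \<subseteq> space M \<times> space M" "F \<in> sets (M \<Otimes>\<^sub>M M)"
  using assms sets.sets_into_space[of F "M \<Otimes>\<^sub>M M"]
  by (auto simp: borel_equiv_def space_pair_measure)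

text \<open>Take \<open>E\<close> from the asymptotic dimension at radius \<open>r + D + 1\<close>. An \<open>F\<close>-class meeting the
  \<open>r\<close>-ball around \<open>x\<close> meets only \<open>E\<close>-classes from a set of size at most \<open>d + 1\<close>, and the set of
  \<open>E\<close>-classes it meets determines its class in \<open>F'\<close>.\<close>

lemma asdim_coarsening:
  assumes asdim: "borel_asdim_le M \<rho> d"
    and F: "borel_equiv M F" "bounded_rel F D" and r: "0 \<le> r"
  obtains F' D' where "borel_equiv M F'" "F \<subseteq> F'" "bounded_rel F' D'"
    "\<And>x. x \<in> space M \<Longrightarrow> ball_count F' x r \<le> 2 ^ (d + 1)"
proof -
  let ?X = "space M"
  have D: "0 \<le> D" "\<And>x y. (x, y) \<in> F \<Longrightarrow> \<rho> x y \<le> ennreal D" using F(2) by (auto simp: bounded_rel_def)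
  \<comment> \<open>The \<open>F\<close>-class of a point of the \<open>r\<close>-ball lies within
    radius \<open>r + D\<close>. The additional 1 yields the strictly positive radius that
    asymptotic dimension demands, as \<open>r\<close> and \<open>D\<close> may both be 0.\<close>
  define r' where "r' = r + D + 1"
  have "r' > 0" using D(1) r by (simp add: r'_def)
  then obtain E R where E: "borel_equiv M E" "R < \<infinity>" "\<And>C. C \<in> ?X // E \<Longrightarrow> ext_diameter \<rho> C \<le> R"
    "\<And>x. x \<in> ?X \<Longrightarrow> finite {C\<in>?X // E. C \<inter> ext_cball ?X \<rho> x r' \<noteq> {}}"
    "\<And>x. x \<in> ?X \<Longrightarrow> card {C\<in>?X // E. C \<inter> ext_cball ?X \<rho> x r' \<noteq> {}} \<le> d + 1"
    using asdim unfolding borel_asdim_le_def by meson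
  note eqF = borel_equivD[OF F(1)] and eqE = borel_equivD[OF E(1)]
  obtain Re where Re: "0 \<le> Re" "R = ennreal Re" using E(2) by (cases R) auto
  have EB: "\<rho> x y \<le> ennreal Re" if "(x, y) \<in> E" for x y
  proof -
    have xX: "x \<in> ?X" using that eqE(2) by auto
    have "\<rho> x y \<le> ext_diameter \<rho> (E `` {x})" unfolding ext_diameter_def
      by (intro SUP_upper2[of x] SUP_upper2[of y]) (use that equiv_class_self[OF eqE(1) xX] in auto)
    also have "\<dots> \<le> R" by (intro E(3) quotientI xX)
    finally show ?thesis using Re by simp
  qed
  define F' where "F' = section_equiv ?X F E"
  have sec: "F `` {x} = F `` {y}" if "(x, y) \<in> F" for x y
    using that equiv_class_eq[OF eqF(1)] by blast
  have "borel_equiv M F'" unfolding F'_def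
    by (intro borel_equiv_section_equiv standard_borel E(1) eqF(3) finite_section_bounded_rel[OF F(2) eqF(2)])
  moreover have "F \<subseteq> F'"
  proof
    fix p assume "p \<in> F"
    then show "p \<in> F'" using eqF(2) sec by (cases p) (auto simp: F'_def section_equiv_def)
  qed
  \<comment> \<open>Of two related points, one reaches the other by an \<open>E\<close>-step
    followed by an \<open>F\<close>-step.\<close>
  moreover have "bounded_rel F' (Re + D)"
  proof -
    have "\<rho> x y \<le> ennreal (Re + D)" if "(x, y) \<in> F'" for x y
    proof -
      have xy: "x \<in> ?X" "y \<in> ?X" "E `` (F `` {x}) = E `` (F `` {y})"
        using that by (auto simp: F'_def section_equiv_def)
      have "x \<in> F `` {x}" "x \<in> E `` {x}" using equiv_class_self eqF(1) eqE(1) xy(1) by metis+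
      then have "x \<in> E `` (F `` {y})" using xy(3) by blast
      then obtain w where w: "(y, w) \<in> F" "(w, x) \<in> E" by blast
      then have wX: "w \<in> ?X" using eqF(2) by auto
      have "\<rho> x y \<le> \<rho> x w + \<rho> w y" by (rule metric_triangle[OF xy(1) wX xy(2)])
      also have "\<dots> = \<rho> w x + \<rho> y w" using metric_sym xy wX by simp
      also have "\<dots> \<le> ennreal Re + ennreal D" by (intro add_mono EB D(2) w)
      also have "\<dots> = ennreal (Re + D)" using Re(1) D(1) by simp
      finally show ?thesis .
    qed
    then show ?thesis using Re(1) D(1) by (auto simp: bounded_rel_def)
  qed
  moreover have "ball_count F' x r \<le> 2 ^ (d + 1)" if x: "x \<in> ?X" for x
  proof -
    define Cs where "Cs = {C\<in>?X // E. C \<inter> ext_cball ?X \<rho> x r' \<noteq> {}}"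
    have Cs: "finite Cs" "card Cs \<le> d + 1" using E(4,5)[OF x] by (auto simp: Cs_def)
    \<comment> \<open>\<open>h\<close> recovers an \<open>F'\<close>-class from the collection of
      \<open>E\<close>-classes that the \<open>F\<close>-class of a member meets, so the subsets of
      \<open>Cs\<close> bound the count.\<close>
    define h where "h \<C> = {w \<in> ?X. E `` (F `` {w}) = \<Union>\<C>}" for \<C>
    have "(\<lambda>y. F' `` {y}) ` ext_cball ?X \<rho> x r \<subseteq> h ` Pow Cs"
    proof safe
      fix y assume "y \<in> ext_cball ?X \<rho> x r"
      then have y: "y \<in> ?X" "\<rho> x y \<le> ennreal r" by (auto simp: ext_cball_def)
      have "(\<lambda>z. E `` {z}) ` (F `` {y}) \<subseteq> Cs"
      proof safe
        fix z assume z: "(y, z) \<in> F"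
        then have zX: "z \<in> ?X" using eqF(2) by auto
        have "\<rho> x z \<le> \<rho> x y + \<rho> y z" by (rule metric_triangle[OF x y(1) zX])
        also have "\<dots> \<le> ennreal r + ennreal D" by (intro add_mono y D(2) z)
        also have "\<dots> = ennreal (r + D)" using r D(1) by simp
        also have "\<dots> \<le> ennreal r'" by (intro ennreal_leI) (simp add: r'_def)
        finally have "z \<in> ext_cball ?X \<rho> x r'" using zX by (simp add: ext_cball_def)
        then have "E `` {z} \<inter> ext_cball ?X \<rho> x r' \<noteq> {}" using equiv_class_self[OF eqE(1) zX] by blast
        then show "E `` {z} \<in> Cs" using quotientI[OF zX, of E] by (simp add: Cs_def)
      qed
      moreover have "F' `` {y} = h ((\<lambda>z. E `` {z}) ` (F `` {y}))"
      proof -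
        have "\<Union>((\<lambda>z. E `` {z}) ` (F `` {y})) = E `` (F `` {y})" by blast
        then show ?thesis using y(1) by (auto simp: h_def F'_def section_equiv_def)
      qed
      ultimately show "F' `` {y} \<in> h ` Pow Cs" by blast
    qed
    then have "ball_count F' x r \<le> card (h ` Pow Cs)"
      unfolding ball_count_def using Cs(1) by (intro card_mono) auto
    also have "\<dots> \<le> card (Pow Cs)" using Cs(1) by (intro card_image_le) simp
    also have "\<dots> = 2 ^ card Cs" by (rule card_Pow[OF Cs(1)])
    also have "\<dots> \<le> 2 ^ (d + 1)" by (intro power_increasing Cs(2)) simp
    finally show ?thesis .
  qed
  ultimately show ?thesis by (rule that)
qed

text \<open>Stage \<open>Suc n\<close> coarsens stage \<open>n\<close> at radius
  \<open>Suc n\<close>. The recursion starts from equality, and the guard \<open>n > 0\<close>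
  exempts that stage from the count.\<close>

lemma asdim_exhaustion:
  assumes asdim: "borel_asdim_le M \<rho> d"
  obtains F where "\<And>n. borel_equiv M (F n)" "incseq F" "\<And>n. \<exists>D. bounded_rel (F n) D"
    "\<And>n x. n > 0 \<Longrightarrow> x \<in> space M \<Longrightarrow> ball_count (F n) x (real n) \<le> 2 ^ (d + 1)"
proof -
  have "\<exists>F. \<forall>n. (borel_equiv M (F n) \<and> (\<exists>D. bounded_rel (F n) D) \<and>
      (n > 0 \<longrightarrow> (\<forall>x\<in>space M. ball_count (F n) x (real n) \<le> 2 ^ (d + 1)))) \<and> F n \<subseteq> F (Suc n)"
  proof (rule dependent_nat_choice)
    \<comment> \<open>Equality is Borel because it is the zero set of the metric.\<close>
    have "Id_on (space M) = {p \<in> space (M \<Otimes>\<^sub>M M). \<rho> (fst p) (snd p) = 0}"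
      using extended_metric by (auto simp: extended_metric_on_def space_pair_measure)
    also have "\<dots> \<in> sets (M \<Otimes>\<^sub>M M)" by measurable
    finally have "borel_equiv M (Id_on (space M))"
      by (auto simp: borel_equiv_def intro!: equivI refl_onI symI transI)
    moreover have "bounded_rel (Id_on (space M)) 0" using metric_refl by (auto simp: bounded_rel_def)
    ultimately show "\<exists>F. borel_equiv M F \<and> (\<exists>D. bounded_rel F D) \<and>
      (0 < (0::nat) \<longrightarrow> (\<forall>x\<in>space M. ball_count F x (real 0) \<le> 2 ^ (d + 1)))" by blast
  next
    fix F and n :: nat
    assume "borel_equiv M F \<and> (\<exists>D. bounded_rel F D) \<and>
      (n > 0 \<longrightarrow> (\<forall>x\<in>space M. ball_count F x (real n) \<le> 2 ^ (d + 1)))"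
    then obtain D where F: "borel_equiv M F" "bounded_rel F D" by blast
    obtain F' D' where "borel_equiv M F'" "F \<subseteq> F'" "bounded_rel F' D'"
      "\<And>x. x \<in> space M \<Longrightarrow> ball_count F' x (real (Suc n)) \<le> 2 ^ (d + 1)"
      using asdim_coarsening[OF asdim F, of "real (Suc n)"] of_nat_0_le_iff by blast
    then show "\<exists>F'. (borel_equiv M F' \<and> (\<exists>D. bounded_rel F' D) \<and>
      (Suc n > 0 \<longrightarrow> (\<forall>x\<in>space M. ball_count F' x (real (Suc n)) \<le> 2 ^ (d + 1)))) \<and> F \<subseteq> F'"
      by blast
  qed
  then obtain F where "\<And>n. borel_equiv M (F n)" "\<And>n. F n \<subseteq> F (Suc n)" "\<And>n. \<exists>D. bounded_rel (F n) D"
    "\<And>n x. n > 0 \<Longrightarrow> x \<in> space M \<Longrightarrow> ball_count (F n) x (real n) \<le> 2 ^ (d + 1)" by blast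
  then show ?thesis by (intro that[of F]) (auto intro: incseq_SucI)
qed

section \<open>Finite index and hyperfiniteness\<close>

lemma finite_common_radius:
  assumes "finite Y" "\<forall>y\<in>Y. \<rho> x y < \<infinity>"
  shows "\<exists>n::nat. n > 0 \<and> (\<forall>y\<in>Y. \<rho> x y \<le> ennreal (real n))"
  using assms
proof (induction Y)
  case (insert y Y)
  then obtain n where n: "n > 0" "\<forall>y\<in>Y. \<rho> x y \<le> ennreal (real n)" by auto
  obtain c where c: "\<rho> x y = ennreal c" "0 \<le> c" using insert.prems by (cases "\<rho> x y") auto
  obtain m where m: "c \<le> real m" using real_arch_simple by blast
  have "\<rho> x z \<le> ennreal (real (max n m))" if "z \<in> insert y Y" for z
  proof (cases "z = y")
    case True
    then show ?thesis using c m by (simp add: ennreal_leI)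
  next
    case False
    then have "\<rho> x z \<le> ennreal (real n)" using n that by simp
    also have "\<dots> \<le> ennreal (real (max n m))" by (intro ennreal_leI) simp
    finally show ?thesis .
  qed
  then show ?case using n(1) by (intro exI[of _ "max n m"]) auto
qed auto

lemma asdim_imp_hyperfinite:
  assumes asdim: "borel_asdim_le M \<rho> d"
  shows "hyperfinite M (finite_distance_rel (space M) \<rho>)"
proof -
  let ?X = "space M"
  obtain F where F: "\<And>n. borel_equiv M (F n)" "incseq F" "\<And>n. \<exists>D. bounded_rel (F n) D"
    "\<And>n x. n > 0 \<Longrightarrow> x \<in> ?X \<Longrightarrow> ball_count (F n) x (real n) \<le> 2 ^ (d + 1)"
    by (rule asdim_exhaustion[OF asdim]) blast
  note eqF = borel_equivD[OF F(1)]
  have fin_F: "finite (F n `` {x})" for n x using F(3)[of n] finite_section_bounded_rel eqF(2) by blast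
  have F_dist: "\<rho> x y < \<infinity>" if "(x, y) \<in> F n" for x y n
  proof -
    obtain D where "bounded_rel (F n) D" using F(3) by blast
    then have "\<rho> x y \<le> ennreal D" using that by (auto simp: bounded_rel_def)
    then show ?thesis using ennreal_less_top le_less_trans infinity_ennreal_def by metis
  qed
  define Ei where "Ei = (\<Union>n. F n)"
  have Ei_sets[measurable]: "Ei \<in> sets (M \<Otimes>\<^sub>M M)" unfolding Ei_def using eqF(3) by blast
  have Ei_sub: "Ei \<subseteq> ?X \<times> ?X" using eqF(2) by (auto simp: Ei_def)
  have F_trans: "(x, z) \<in> F n" if "(x, y) \<in> F n" "(y, z) \<in> F n" for x y z n
    using eqF(1)[of n] that by (auto elim!: equivE dest: transD)
  have F_sym: "(y, x) \<in> F n" if "(x, y) \<in> F n" for x y n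
    using eqF(1)[of n] that by (auto elim!: equivE dest: symD)
  have F_refl: "(x, x) \<in> F n" if "x \<in> ?X" for x n
    using eqF(1)[of n] that by (auto elim!: equivE dest: refl_onD)
  have F_mono: "(x, y) \<in> F n" if "(x, y) \<in> F m" "m \<le> n" for x y m n
    using F(2) that by (auto simp: incseq_def)
  have eqEi: "equiv ?X Ei"
  proof (rule equivI)
    show "Ei \<subseteq> ?X \<times> ?X" by (rule Ei_sub)
    show "refl_on ?X Ei" using Ei_sub F_refl by (auto simp: Ei_def intro!: refl_onI)
    show "sym Ei" using F_sym by (auto simp: Ei_def intro!: symI)
    show "trans Ei"
    proof (rule transI)
      fix x y z assume "(x, y) \<in> Ei" "(y, z) \<in> Ei"
      then obtain m n where "(x, y) \<in> F m" "(y, z) \<in> F n" by (auto simp: Ei_def)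
      then have "(x, y) \<in> F (max m n)" "(y, z) \<in> F (max m n)" using F_mono by auto
      then show "(x, z) \<in> Ei" using F_trans unfolding Ei_def by blast
    qed
  qed
  have dist_trans: "\<rho> x z < \<infinity>" if "\<rho> x y < \<infinity>" "\<rho> y z < \<infinity>" "x \<in> ?X" "y \<in> ?X" "z \<in> ?X" for x y z
    using metric_triangle[OF that(3-5)] that(1,2) by (auto simp: less_top[symmetric] top_unique)
  define good where "good r x \<longleftrightarrow> (\<forall>y\<in>?X. \<rho> x y < \<infinity> \<longrightarrow> (\<exists>z\<in>?X. \<rho> x z \<le> ennreal (real r) \<and> (z, y) \<in> Ei))"
    for r :: nat and x
  have good_ex: "\<exists>r. good r x" if x: "x \<in> ?X" for x
  proof -
    define Y where "Y = {y\<in>?X. \<rho> x y < \<infinity>}"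
    \<comment> \<open>Finitely many \<open>Ei\<close>-classes have representatives in one ball of
      integer radius \<open>n\<close>. Since \<open>F n\<close> is contained in \<open>Ei\<close>,
      distinct \<open>Ei\<close>-classes give distinct \<open>F n\<close>-classes, and the uniform
      bound applies.\<close>
    have bdd: "card G \<le> 2 ^ (d + 1)" if G: "G \<subseteq> (\<lambda>y. Ei `` {y}) ` Y" "finite G" for G
    proof -
      obtain Z where Z: "Z \<subseteq> Y" "inj_on (\<lambda>y. Ei `` {y}) Z" "G = (\<lambda>y. Ei `` {y}) ` Z"
        using G(1) by (auto simp: subset_image_inj)
      then have "finite Z" using G(2) finite_imageD by blast
      moreover have "\<forall>y\<in>Z. \<rho> x y < \<infinity>" using Z(1) by (auto simp: Y_def)
      ultimately obtain n where n: "n > 0" "\<forall>y\<in>Z. \<rho> x y \<le> ennreal (real n)"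
        using finite_common_radius[of Z x] by blast
      have "inj_on (\<lambda>y. F n `` {y}) Z"
      proof (rule inj_onI)
        fix y y' assume y: "y \<in> Z" "y' \<in> Z" "F n `` {y} = F n `` {y'}"
        then have "y \<in> ?X" "y' \<in> ?X" using Z(1) by (auto simp: Y_def)
        then have "(y, y') \<in> Ei" using y(3) F_refl[of y' n] unfolding Ei_def by blast
        then have "Ei `` {y} = Ei `` {y'}" by (rule equiv_class_eq[OF eqEi])
        then show "y = y'" using Z(2) y by (auto dest: inj_onD)
      qed
      then have "card Z = card ((\<lambda>y. F n `` {y}) ` Z)" by (simp add: card_image)
      also have "\<dots> \<le> ball_count (F n) x (real n)" unfolding ball_count_def
        using n Z(1) finite_ball[OF x] by (intro card_mono image_mono) (auto simp: ext_cball_def Y_def)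
      also have "\<dots> \<le> 2 ^ (d + 1)" by (rule F(4)[OF n(1) x])
      finally show ?thesis using Z(2,3) by (simp add: card_image)
    qed
    have "finite ((\<lambda>y. Ei `` {y}) ` Y)"
      by (rule finite_if_finite_subsets_card_bdd[of _ "2 ^ (d + 1)", THEN conjunct1]) (use bdd in blast)
    then obtain Z where Z: "Z \<subseteq> Y" "finite Z" "(\<lambda>y. Ei `` {y}) ` Y = (\<lambda>y. Ei `` {y}) ` Z"
      using finite_subset_image[of "(\<lambda>y. Ei `` {y}) ` Y" "\<lambda>y. Ei `` {y}" Y] by blast
    have "\<forall>y\<in>Z. \<rho> x y < \<infinity>" using Z(1) by (auto simp: Y_def)
    then obtain r where r: "\<forall>y\<in>Z. \<rho> x y \<le> ennreal (real r)"
      using finite_common_radius[of Z x] Z(2) by blast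
    have "good r x" unfolding good_def
    proof (intro ballI impI)
      fix y assume y: "y \<in> ?X" "\<rho> x y < \<infinity>"
      then have "Ei `` {y} \<in> (\<lambda>y. Ei `` {y}) ` Z" using Z(3) by (auto simp: Y_def)
      then obtain z where z: "z \<in> Z" "Ei `` {y} = Ei `` {z}" by auto
      then have "(z, y) \<in> Ei" using equiv_class_self[OF eqEi y(1)] by blast
      then show "\<exists>z\<in>?X. \<rho> x z \<le> ennreal (real r) \<and> (z, y) \<in> Ei" using r z(1) Z(1) by (auto simp: Y_def)
    qed
    then show ?thesis ..
  qed
  obtain \<phi> :: "'a \<Rightarrow> nat \<Rightarrow> real" where \<phi>: "polish_embedding M \<phi>"
    using standard_borel_polish_embedding[OF standard_borel] .
  note \<phi>2 = polish_embedding_pair[OF \<phi> \<phi>]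
  have fin_ball: "finite {y \<in> ?X. \<rho> x y \<le> ennreal (real r) \<and> Q y}" if "x \<in> ?X" for x r Q
    by (rule finite_subset[OF _ finite_ball[OF that, of "real r"]]) (auto simp: ext_cball_def)
  define T where "T r = {p \<in> space (M \<Otimes>\<^sub>M M). \<exists>z\<in>?X. \<rho> (fst p) z \<le> ennreal (real r) \<and> (z, snd p) \<in> Ei}" for r :: nat
  have [measurable]: "T r \<in> sets (M \<Otimes>\<^sub>M M)" for r unfolding T_def
  proof (rule sets_Collect_Bex_finite[OF \<phi>2 \<phi>])
    show "{p \<in> space ((M \<Otimes>\<^sub>M M) \<Otimes>\<^sub>M M). \<rho> (fst (fst p)) (snd p) \<le> ennreal (real r) \<and> (snd p, snd (fst p)) \<in> Ei}
      \<in> sets ((M \<Otimes>\<^sub>M M) \<Otimes>\<^sub>M M)" by measurable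
  qed (auto intro: fin_ball simp: space_pair_measure)
  \<comment> \<open>Infinitely many \<open>y\<close> may be at finite distance; sorting them by
    integer radius \<open>n\<close> makes each quantifier range over a finite ball, and goodness
    becomes a countable intersection.\<close>
  define W where "W r n = {x \<in> ?X. \<exists>y\<in>?X. \<rho> x y \<le> ennreal (real n) \<and> (x, y) \<notin> T r}" for r n :: nat
  have [measurable]: "W r n \<in> sets M" for r n unfolding W_def
  proof (rule sets_Collect_Bex_finite[OF \<phi> \<phi>])
    show "{p \<in> space (M \<Otimes>\<^sub>M M). \<rho> (fst p) (snd p) \<le> ennreal (real n) \<and> (fst p, snd p) \<notin> T r} \<in> sets (M \<Otimes>\<^sub>M M)"
      by measurable
  qed (rule fin_ball)
  have good_iff: "good r x \<longleftrightarrow> (\<forall>n. x \<notin> W r n)" if x: "x \<in> ?X" for r x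
  proof -
    have "\<rho> x y < \<infinity> \<longleftrightarrow> (\<exists>n::nat. \<rho> x y \<le> ennreal (real n))" for y
      using finite_common_radius[of "{y}" x] ennreal_less_top[THEN le_less_trans[rotated]]
      by (metis empty_iff finite.emptyI finite.insertI infinity_ennreal_def insert_iff)
    then show ?thesis using x unfolding good_def W_def T_def by (auto simp: space_pair_measure)
  qed
  \<comment> \<open>\<open>N x\<close> is the least radius at which the ball around \<open>x\<close> meets every \<open>Ei\<close>-class at finite
    distance from \<open>x\<close>, so finite-distance points have balls meeting the same \<open>Ei\<close>-classes.\<close>
  define N where "N x = (LEAST r. \<forall>n. x \<notin> W r n)" for x
  have [measurable]: "N \<in> measurable M (count_space UNIV)" unfolding N_def by measurable
  have N_good: "good (N x) x" if "x \<in> ?X" for x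
    using LeastI_ex[OF good_ex[OF that, unfolded good_iff[OF that]]] good_iff[OF that] by (simp add: N_def)
  define S where "S = {(x, y) \<in> ?X \<times> ?X. \<rho> x y \<le> ennreal (real (N x))}"
  have S_sets: "S \<in> sets (M \<Otimes>\<^sub>M M)"
  proof -
    have "S = {p \<in> space (M \<Otimes>\<^sub>M M). \<rho> (fst p) (snd p) \<le> ennreal (real (N (fst p)))}"
      by (auto simp: S_def space_pair_measure)
    also have "\<dots> \<in> sets (M \<Otimes>\<^sub>M M)" by measurable
    finally show ?thesis .
  qed
  have S_fin: "finite (S `` {x})" for x
  proof (cases "x \<in> ?X")
    case True
    have "S `` {x} = {y \<in> ?X. \<rho> x y \<le> ennreal (real (N x)) \<and> True}" using True by (auto simp: S_def)
    then show ?thesis using fin_ball[OF True, of "N x" "\<lambda>_. True"] by simp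
  qed (simp add: S_def)
  have S_refl: "(x, x) \<in> S" if "x \<in> ?X" for x using that metric_refl by (simp add: S_def)
  have S_dist: "\<rho> x y < \<infinity>" if "(x, y) \<in> S" for x y
    using that le_less_trans[OF _ ennreal_less_top] by (auto simp: S_def)
  define G where "G k = section_equiv ?X S (F k)" for k
  have G_equiv: "borel_equiv M (G k)" for k unfolding G_def
    by (intro borel_equiv_section_equiv standard_borel F(1) S_sets S_fin)
  have G_near: "\<exists>w. (y, w) \<in> S \<and> (w, x) \<in> F k" if "(x, y) \<in> G k" for x y k
  proof -
    have xy: "x \<in> ?X" "F k `` (S `` {x}) = F k `` (S `` {y})" using that by (auto simp: G_def section_equiv_def)
    have "x \<in> F k `` (S `` {x})" using S_refl F_refl xy(1) by blast
    then show ?thesis using xy(2) by blast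
  qed
  \<comment> \<open>Inclusions reached at stage \<open>m\<close> persist at all later ones. This
    yields the monotonicity of \<open>G\<close> and also merges the two stages found in the
    exhaustion.\<close>
  have image_le: "F n `` (S `` {x}) \<subseteq> F n `` (S `` {y})"
    if "S `` {x} \<subseteq> F m `` (S `` {y})" "m \<le> n" for x y m n
    using that F_mono[OF _ that(2)] F_trans by blast
  have "finite_borel_equiv M (G k)" for k
  proof -
    have "finite C" if C: "C \<in> ?X // G k" for C
    proof -
      obtain y where y: "y \<in> ?X" "C = G k `` {y}" using C by (rule quotientE)
      \<comment> \<open>A point \<open>G k\<close>-related to \<open>y\<close> is
        \<open>F k\<close>-related to a member of the finite section at \<open>y\<close>.\<close>
      have "C \<subseteq> (\<Union>w\<in>S `` {y}. F k `` {w})"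
      proof
        fix x assume "x \<in> C"
        then have "(x, y) \<in> G k" using y borel_equivD(1)[OF G_equiv] by (auto elim!: equivE dest: symD)
        then show "x \<in> (\<Union>w\<in>S `` {y}. F k `` {w})" using G_near by blast
      qed
      moreover have "finite (\<Union>w\<in>S `` {y}. F k `` {w})" using S_fin fin_F by blast
      ultimately show ?thesis by (rule finite_subset)
    qed
    then show ?thesis using G_equiv by (simp add: finite_borel_equiv_def)
  qed
  moreover have "incseq G"
  proof (rule incseq_SucI, rule subsetI)
    fix k p assume "p \<in> G k"
    then obtain x y where xy: "p = (x, y)" "x \<in> ?X" "y \<in> ?X" "F k `` (S `` {x}) = F k `` (S `` {y})"
      by (auto simp: G_def section_equiv_def)
    \<comment> \<open>Reflexivity turns equality of saturations into the inclusions that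
      \<open>image_le\<close> takes as input.\<close>
    have "S `` {z} \<subseteq> F k `` (S `` {z})" for z using F_refl by (auto simp: S_def)
    then have "S `` {x} \<subseteq> F k `` (S `` {y})" "S `` {y} \<subseteq> F k `` (S `` {x})" using xy(4) by blast+
    then have "F (Suc k) `` (S `` {x}) = F (Suc k) `` (S `` {y})" by (intro equalityI image_le[of _ k]) auto
    then show "p \<in> G (Suc k)" using xy by (simp add: G_def section_equiv_def)
  qed
  moreover have "finite_distance_rel ?X \<rho> = (\<Union>k. G k)"
  proof (intro equalityI subsetI)
    fix p assume "p \<in> finite_distance_rel ?X \<rho>"
    then obtain x y where xy: "p = (x, y)" "x \<in> ?X" "y \<in> ?X" "\<rho> x y < \<infinity>"
      by (auto simp: finite_distance_rel_def)
    \<comment> \<open>The good ball at \<open>b\<close> meets the \<open>Ei\<close>-class of each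
      point in the section at \<open>a\<close>, at a stage depending on the point; the section is
      finite, so the largest stage serves all.\<close>
    have stage: "\<exists>k. S `` {a} \<subseteq> F k `` (S `` {b})" if ab: "a \<in> ?X" "b \<in> ?X" "\<rho> b a < \<infinity>" for a b
    proof -
      have "\<exists>k. \<exists>w. (b, w) \<in> S \<and> (w, z) \<in> F k" if z: "z \<in> S `` {a}" for z
      proof -
        have "z \<in> ?X" "\<rho> a z < \<infinity>" using z S_dist by (auto simp: S_def)
        then have "\<rho> b z < \<infinity>" using dist_trans[of b a z] ab by blast
        then obtain w where "w \<in> ?X" "\<rho> b w \<le> ennreal (real (N b))" "(w, z) \<in> Ei"
          using N_good[OF ab(2)] \<open>z \<in> ?X\<close> unfolding good_def by blast
        then show ?thesis using ab(2) by (auto simp: S_def Ei_def)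
      qed
      then obtain k where k: "\<And>z. z \<in> S `` {a} \<Longrightarrow> \<exists>w. (b, w) \<in> S \<and> (w, z) \<in> F (k z)" by metis
      define K where "K = Max (k ` (S `` {a}))"
      have "k z \<le> K" if "z \<in> S `` {a}" for z
        unfolding K_def using S_fin that by (intro Max_ge) auto
      then have "S `` {a} \<subseteq> F K `` (S `` {b})" using k F_mono by blast
      then show ?thesis ..
    qed
    obtain k1 where "S `` {x} \<subseteq> F k1 `` (S `` {y})" using stage[of x y] xy metric_sym by auto
    moreover obtain k2 where "S `` {y} \<subseteq> F k2 `` (S `` {x})" using stage[of y x] xy by auto
    ultimately have "F (max k1 k2) `` (S `` {x}) = F (max k1 k2) `` (S `` {y})"
      by (intro equalityI image_le[of x k1] image_le[of y k2]) auto
    then show "p \<in> (\<Union>k. G k)" using xy by (auto simp: G_def section_equiv_def)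
  next
    fix p assume "p \<in> (\<Union>k. G k)"
    then obtain x y k where xy: "p = (x, y)" "(x, y) \<in> G k" by (cases p) auto
    then have X: "x \<in> ?X" "y \<in> ?X" by (auto simp: G_def section_equiv_def)
    obtain w where w: "(y, w) \<in> S" "(w, x) \<in> F k" using G_near xy(2) by blast
    have "\<rho> y x < \<infinity>" using dist_trans[of y w x] S_dist[OF w(1)] F_dist[OF w(2)] w(1) X by (auto simp: S_def)
    then show "p \<in> finite_distance_rel ?X \<rho>" using X xy(1) metric_sym by (auto simp: finite_distance_rel_def)
  qed
  ultimately show ?thesis unfolding hyperfinite_def by blast
qed

end

theorem theorem1p7:
  fixes M :: "'a measure" and \<rho> :: "'a \<Rightarrow> 'a \<Rightarrow> ennreal"
  assumes "standard_borel M"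
    and "extended_metric_on (space M) \<rho>"
    and "(\<lambda>(x, y). \<rho> x y) \<in> borel_measurable (M \<Otimes>\<^sub>M M)"
    and "proper_on (space M) \<rho>"
    and "borel_asdim M \<rho> < \<infinity>"
  shows "hyperfinite M (finite_distance_rel (space M) \<rho>)"
proof -
  interpret borel_proper_space M \<rho> using assms by unfold_locales
  have "{enat d | d. borel_asdim_le M \<rho> d} \<noteq> {}"
    using assms(5) by (auto simp: borel_asdim_def Inf_enat_def split: if_splits)
  then obtain d where "borel_asdim_le M \<rho> d" by auto
  then show ?thesis by (rule asdim_imp_hyperfinite)
qed

end
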